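(* Let $$c_1=\frac{1}{10}(4-\sqrt6),\qquad c_2=\frac1{10}(4+\sqrt6),\qquad \phi=\frac1{50}(2+3\sqrt6).$$ Then the 2-stage modified two-derivative diagonally implicit Runge--Kutta method with nodes $c_1,c_2$ and coefficients $$a_{11}(\mu)=\frac{1}{\mu^2}\left(1-\frac{2}{E_\mu^{+}(c_1)}\right),\quad a_{21}(\mu)=\phi,\quad a_{22}(\mu)=\frac{E_\mu^{+}(c_2)-\left(2+\phi\mu^2E_\mu^{+}(c_1)\right)}{\mu^2E_\mu^{+}(c_2)},$$ $$\xi_1(\mu)=\frac{E_\mu^{-}(c_1)}{c_1\mu E_\mu^{+}(c_1)},\quad \xi_2(\mu)=\frac{E_\mu^{-}(c_2)-\phi\mu^2E_\mu^{-}(c_1-c_2)}{c_2\mu E_\mu^{+}(c_2)},$$ $$b_1(\mu)=\frac{E_\mu^{-}(c_2)+E_\mu^{-}(1-c_2)-\mu E_\mu^{+}(c_2)}{\mu^2E_\mu^{-}(c_1-c_2)},\quad b_2(\mu)=\frac{\mu E_\mu^{+}(c_1)-E_\mu^{-}(c_1)-E_\mu^{-}(1-c_1)}{\mu^2E_\mu^{-}(c_1-c_2)}$$ is exponentially fitted (it satisfies the fitting conditions for $e^{\pm\mathrm{i}\omega x}$) and has order of consistency five.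
   Context: A 2-stage modified two-derivative diagonally implicit Runge--Kutta (TDDIRK) method for $y'=f(y)$, with $g(y)=f'(y)f(y)$, stepsize $h$, frequency $\omega>0$ and $\mu=\mathrm{i}\omega h$, is $$Y_i = y_n+\xi_i(\mu)c_{i} h f(y_n)+h^2\sum_{j=1}^{i} a_{ij}(\mu)g(Y_j),\ i=1,2,\qquad y_{n+1} = y_n+h f(y_n)+h^2\sum_{i=1}^2 b_i(\mu)g(Y_i).$$ $E_\mu^{+}(\zeta)=e^{\zeta\mu}+e^{-\zeta\mu}$, $E_\mu^{-}(\zeta)=e^{\zeta\mu}-e^{-\zeta\mu}$ for $\zeta\in\mathbb{R}$. Removable singularities at $\mu=0$ are filled by limits; $h$ is small enough that the denominators do not vanish. Fitting conditions for $e^{\pm\mathrm{i}\omega x}$ (degree $(0,1)$), for both choices of sign: $$\mu^2\sum_{j=1}^{i}a_{ij}(\mu)e^{\pm c_j\mu}\pm\xi_i(\mu)c_i\mu=e^{\pm c_i\mu}-1\ (i=1,2),\qquad \mu^2\sum_{i=1}^{2}b_i(\mu)e^{\pm c_i\mu}=e^{\pm\mu}-1\mp\mu.$$ Order of consistency $p$: for $f$ sufficiently smooth and $y(x_n)=y_n$, $y(x_n+h)-y_{n+1}=\mathcal{O}(h^{p+1})$ as $h\to0$ (with $\omega$ fixed). *)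

theory Defs
  imports "HOL-Analysis.Analysis"
begin

section \<open>Two-stage modified two-derivative diagonally implicit Runge--Kutta methods\<close>

text \<open>Stages are numbered 1 and 2; \<open>acoef\<close> is only read at \<open>i j\<close> with \<open>1 \<le> j \<le> i \<le> 2\<close>.
  Coefficients are functions of the complex argument \<open>\<mu> = \<i> \<omega> h\<close>.\<close>

record tddirk =
  node :: "nat \<Rightarrow> real"
  xicoef :: "nat \<Rightarrow> complex \<Rightarrow> complex"
  acoef :: "nat \<Rightarrow> nat \<Rightarrow> complex \<Rightarrow> complex"
  bcoef :: "nat \<Rightarrow> complex \<Rightarrow> complex"

definition mu_of :: "real \<Rightarrow> real \<Rightarrow> complex" where
  "mu_of \<omega> h = \<i> * of_real \<omega> * of_real h"

definition real_coefficients :: "tddirk \<Rightarrow> complex \<Rightarrow> bool" where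
  "real_coefficients M \<mu> \<longleftrightarrow>
     (\<forall>i\<in>{1..2}. xicoef M i \<mu> \<in> \<real> \<and> bcoef M i \<mu> \<in> \<real> \<and> (\<forall>j\<in>{1..i}. acoef M i j \<mu> \<in> \<real>))"

definition second_derivative_field :: "('a::euclidean_space \<Rightarrow> 'a) \<Rightarrow> 'a \<Rightarrow> 'a" where
  "second_derivative_field f y = frechet_derivative f (at y) (f y)"

text \<open>The method acts on real vectors, so the coefficients enter through \<open>Re\<close>.  This loses
  nothing where \<open>real_coefficients\<close> holds, which the definition of consistency below demands.\<close>

definition stage_equations ::
    "tddirk \<Rightarrow> ('a::euclidean_space \<Rightarrow> 'a) \<Rightarrow> real \<Rightarrow> real \<Rightarrow> 'a \<Rightarrow> (nat \<Rightarrow> 'a) \<Rightarrow> bool" where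
  "stage_equations M f \<omega> h yn Y \<longleftrightarrow>
     (\<forall>i\<in>{1..2}. Y i = yn + (Re (xicoef M i (mu_of \<omega> h)) * node M i * h) *\<^sub>R f yn
        + h\<^sup>2 *\<^sub>R (\<Sum>j=1..i. Re (acoef M i j (mu_of \<omega> h)) *\<^sub>R second_derivative_field f (Y j)))"

definition step_value ::
    "tddirk \<Rightarrow> ('a::euclidean_space \<Rightarrow> 'a) \<Rightarrow> real \<Rightarrow> real \<Rightarrow> 'a \<Rightarrow> (nat \<Rightarrow> 'a) \<Rightarrow> 'a" where
  "step_value M f \<omega> h yn Y =
     yn + h *\<^sub>R f yn
        + h\<^sup>2 *\<^sub>R (\<Sum>i=1..2. Re (bcoef M i (mu_of \<omega> h)) *\<^sub>R second_derivative_field f (Y i))"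

section \<open>Exponential fitting\<close>

text \<open>\<open>s\<close> is the common sign of the conditions for \<open>e\<close> to the \<open>\<plusminus>\<i> \<omega> x\<close>.\<close>

definition exponentially_fitted_at :: "tddirk \<Rightarrow> complex \<Rightarrow> bool" where
  "exponentially_fitted_at M \<mu> \<longleftrightarrow>
     (\<forall>s\<in>{1, -1}.
        (\<forall>i\<in>{1..2}.
           \<mu>\<^sup>2 * (\<Sum>j=1..i. acoef M i j \<mu> * exp (s * of_real (node M j) * \<mu>))
             + s * xicoef M i \<mu> * of_real (node M i) * \<mu>
           = exp (s * of_real (node M i) * \<mu>) - 1) \<and>
        \<mu>\<^sup>2 * (\<Sum>i=1..2. bcoef M i \<mu> * exp (s * of_real (node M i) * \<mu>)) = exp (s * \<mu>) - 1 - s * \<mu>)"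

section \<open>Order of consistency\<close>

text \<open>\<open>C\<^sup>k\<close> smoothness, meant for open \<open>S\<close>: all iterated directional derivatives up to order
  \<open>k\<close> exist and are continuous, which in finite dimension is the usual notion.\<close>

primrec Ck_on :: "nat \<Rightarrow> 'a::euclidean_space set \<Rightarrow> ('a \<Rightarrow> 'b::euclidean_space) \<Rightarrow> bool" where
  "Ck_on 0 S f \<longleftrightarrow> continuous_on S f"
| "Ck_on (Suc k) S f \<longleftrightarrow>
     (\<forall>x\<in>S. f differentiable (at x)) \<and> (\<forall>v. Ck_on k S (\<lambda>x. frechet_derivative f (at x) v))"

text \<open>The stage equations are implicit and may have spurious solutions far from \<open>yn\<close>.  As
  usual, the method follows the solution near \<open>yn\<close>: for some fixed ball around \<open>yn\<close> and all
  small \<open>h > 0\<close> the stage values in that ball are required to exist and to be unique, and these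
  define the numerical step.\<close>

definition consistent_of_order ::
    "nat \<Rightarrow> tddirk \<Rightarrow> real \<Rightarrow> 'a::euclidean_space set \<Rightarrow> ('a \<Rightarrow> 'a) \<Rightarrow> bool" where
  "consistent_of_order p M \<omega> U f \<longleftrightarrow>
     (\<forall>xn T yn y.
        T > 0 \<and> y xn = yn \<and>
        (\<forall>x\<in>{xn..xn + T}. y x \<in> U \<and> (y has_vector_derivative f (y x)) (at x within {xn..xn + T})) \<longrightarrow>
        (\<exists>r>0. \<exists>Y. cball yn r \<subseteq> U \<and>
           (\<forall>\<^sub>F h in at_right 0.
              real_coefficients M (mu_of \<omega> h) \<and>
              Y h \<in> {1..2} \<rightarrow>\<^sub>E ball yn r \<and> stage_equations M f \<omega> h yn (Y h) \<and>
              (\<forall>Z \<in> {1..2} \<rightarrow>\<^sub>E ball yn r. stage_equations M f \<omega> h yn Z \<longrightarrow> Z = Y h)) \<and>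
           (\<lambda>h. norm (y (xn + h) - step_value M f \<omega> h yn (Y h))) \<in> O[at_right 0](\<lambda>h. h ^ (p + 1))))"

section \<open>The method with nodes \<open>(4 \<mp> \<surd>6) / 10\<close>\<close>

definition Eplus :: "complex \<Rightarrow> real \<Rightarrow> complex" where
  "Eplus \<mu> \<zeta> = exp (of_real \<zeta> * \<mu>) + exp (- of_real \<zeta> * \<mu>)"

definition Eminus :: "complex \<Rightarrow> real \<Rightarrow> complex" where
  "Eminus \<mu> \<zeta> = exp (of_real \<zeta> * \<mu>) - exp (- of_real \<zeta> * \<mu>)"

definition c1 :: real where "c1 = (4 - sqrt 6) / 10"
definition c2 :: real where "c2 = (4 + sqrt 6) / 10"
definition phi :: real where "phi = (2 + 3 * sqrt 6) / 50"

definition fill_at_0 :: "(complex \<Rightarrow> complex) \<Rightarrow> complex \<Rightarrow> complex" where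
  "fill_at_0 F \<mu> = (if \<mu> = 0 then Lim (at 0) F else F \<mu>)"

definition a11 :: "complex \<Rightarrow> complex" where
  "a11 = fill_at_0 (\<lambda>\<mu>. 1 / \<mu>\<^sup>2 * (1 - 2 / Eplus \<mu> c1))"

definition a21 :: "complex \<Rightarrow> complex" where
  "a21 = (\<lambda>\<mu>. of_real phi)"

definition a22 :: "complex \<Rightarrow> complex" where
  "a22 = fill_at_0 (\<lambda>\<mu>. (Eplus \<mu> c2 - (2 + of_real phi * \<mu>\<^sup>2 * Eplus \<mu> c1)) / (\<mu>\<^sup>2 * Eplus \<mu> c2))"

definition xi1 :: "complex \<Rightarrow> complex" where
  "xi1 = fill_at_0 (\<lambda>\<mu>. Eminus \<mu> c1 / (of_real c1 * \<mu> * Eplus \<mu> c1))"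

definition xi2 :: "complex \<Rightarrow> complex" where
  "xi2 = fill_at_0 (\<lambda>\<mu>. (Eminus \<mu> c2 - of_real phi * \<mu>\<^sup>2 * Eminus \<mu> (c1 - c2))
                          / (of_real c2 * \<mu> * Eplus \<mu> c2))"

definition b1 :: "complex \<Rightarrow> complex" where
  "b1 = fill_at_0 (\<lambda>\<mu>. (Eminus \<mu> c2 + Eminus \<mu> (1 - c2) - \<mu> * Eplus \<mu> c2)
                         / (\<mu>\<^sup>2 * Eminus \<mu> (c1 - c2)))"

definition b2 :: "complex \<Rightarrow> complex" where
  "b2 = fill_at_0 (\<lambda>\<mu>. (\<mu> * Eplus \<mu> c1 - Eminus \<mu> c1 - Eminus \<mu> (1 - c1))
                         / (\<mu>\<^sup>2 * Eminus \<mu> (c1 - c2)))"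

definition ef_tddirk :: tddirk where
  "ef_tddirk =
     \<lparr> node = (\<lambda>i. if i = 1 then c1 else c2),
       xicoef = (\<lambda>i. if i = 1 then xi1 else xi2),
       acoef = (\<lambda>i j. if i = 1 then a11 else if j = 1 then a21 else a22),
       bcoef = (\<lambda>i. if i = 1 then b1 else b2) \<rparr>"

text \<open>The zero of the denominators at \<open>\<mu> = 0\<close> is the removable one.\<close>

definition denominators_nonzero :: "complex \<Rightarrow> bool" where
  "denominators_nonzero \<mu> \<longleftrightarrow>
     Eplus \<mu> c1 \<noteq> 0 \<and> Eplus \<mu> c2 \<noteq> 0 \<and> (\<mu> \<noteq> 0 \<longrightarrow> Eminus \<mu> (c1 - c2) \<noteq> 0)"

end

theory Submission
  imports Defs "HOL-Real_Asymp.Real_Asymp"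
begin

text \<open>Fitting is an algebraic identity in \<open>exp (c\<^sub>i \<mu>)\<close> and \<open>exp \<mu>\<close>.  For the order, compare the stages
  with the exact solution: \<open>Y\<^sub>i - y(x\<^sub>n + c\<^sub>i h) = \<kappa>\<^sub>i h\<^sup>3 (y''' + \<omega>\<^sup>2 y') + O(h\<^sup>4)\<close> with
  \<open>\<kappa>\<^sub>1 = c\<^sub>1\<^sup>3/3\<close> and \<open>\<kappa>\<^sub>2 = c\<^sub>2\<^sup>3/3 - \<phi> (c\<^sub>2 - c\<^sub>1)\<close>.  The nodes are the zeros of the quadratic orthogonal to
  \<open>1\<close> and \<open>x\<close> for the weight \<open>1 - x\<close> on \<open>[0,1]\<close>, so that the limit weights integrate \<open>1, x, x\<^sup>2, x\<^sup>3\<close>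
  exactly, and \<open>\<phi>\<close> is the value that makes \<open>b\<^sub>1 \<kappa>\<^sub>1 + b\<^sub>2 \<kappa>\<^sub>2\<close> vanish at \<open>\<mu> = 0\<close>.  Only the values of
  \<open>g\<close> along the solution and a linearization of \<open>g\<close> at \<open>y\<^sub>n\<close> enter, so one-dimensional Taylor
  expansions suffice.\<close>

section \<open>Continuously differentiable maps\<close>

text \<open>The coefficients depend on \<open>h\<close> and differ from their limits by O(h^2);
  replacing the weights by their limits would cost O(h^4) in a step, two orders too many. The
  fitting conditions repair this: they force the two lowest moments of the weights to be correct up
  to O(h^4). The target moments 1/2, 1/6, 1/12, 1/20 are the integrals of (1 - x) x^k over [0,1];
  the weight 1 - x is the kernel in y(1) = y(0) + y'(0) + int (1 - x) y''(x) dx. The second obstacle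
  is the low stage order: an h^3 error in the stages reaches the step at h^5. A fitted stage is
  exact for constants and for exp(+-i \<omega> x), so its leading defect, a combination of y' and
  y''', is a multiple of y''' + \<omega>^2 y'. Both stages therefore err in the same direction, and
  one scalar equation, the one solved by \<open>phi\<close>, cancels the errors. A field of class
  C^5 has solutions of class C^6, just enough for a remainder of order six.\<close>

lemma has_derivative_frechet:
  "Ck_on (Suc k) S f \<Longrightarrow> x \<in> S \<Longrightarrow> (f has_derivative frechet_derivative f (at x)) (at x)"
  by (simp add: frechet_derivative_works[symmetric])

lemma Ck_on_mono_order: "Ck_on (Suc k) S f \<Longrightarrow> Ck_on k S f"
proof (induction k arbitrary: f)
  case 0
  then show ?case
    by (auto intro!: continuous_at_imp_continuous_on differentiable_imp_continuous_within)
qed auto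

lemma Ck_on_le: "Ck_on m S f \<Longrightarrow> k \<le> m \<Longrightarrow> Ck_on k S f"
  by (induction m) (auto simp del: Ck_on.simps elim: le_SucE dest: Ck_on_mono_order)

text \<open>Openness makes derivatives at points of \<open>S\<close> depend on values in
  \<open>S\<close> only. Formulas for a derivative that are valid just on \<open>S\<close> can thus
  replace \<open>frechet_derivative\<close>.\<close>

lemma Ck_on_cong:
  assumes "open S" "\<And>x. x \<in> S \<Longrightarrow> f x = g x" "Ck_on k S f"
  shows "Ck_on k S g"
  using assms(2,3)
proof (induction k arbitrary: f g)
  case 0
  then show ?case using continuous_on_cong by fastforce
next
  case (Suc k)
  have D: "(g has_derivative frechet_derivative f (at x)) (at x)" if "x \<in> S" for x
    by (rule has_derivative_transform_within_open[OF has_derivative_frechet[OF Suc.prems(2) that] assms(1) that])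
      (use Suc.prems(1) in auto)
  have "frechet_derivative g (at x) = frechet_derivative f (at x)" if "x \<in> S" for x
    using frechet_derivative_at[OF D[OF that]] by simp
  then have "Ck_on k S (\<lambda>x. frechet_derivative g (at x) v)" for v
    using Suc.IH[of "\<lambda>x. frechet_derivative f (at x) v" "\<lambda>x. frechet_derivative g (at x) v"] Suc.prems(2) by auto
  then show ?case using D by (auto simp: differentiable_def)
qed

section \<open>Closure properties of the smoothness classes\<close>

lemma Ck_on_SucI:
  assumes "open S" "\<And>x. x \<in> S \<Longrightarrow> (f has_derivative D x) (at x)" "\<And>v. Ck_on k S (\<lambda>x. D x v)"
  shows "Ck_on (Suc k) S f"
proof -
  have "frechet_derivative f (at x) = D x" if "x \<in> S" for x
    using frechet_derivative_at[OF assms(2)[OF that]] by simp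
  then have "Ck_on k S (\<lambda>x. frechet_derivative f (at x) v)" for v
    by (intro Ck_on_cong[OF assms(1) _ assms(3)[of v]]) auto
  then show ?thesis using assms(2) by (auto simp: differentiable_def)
qed

lemma Ck_on_const: "open S \<Longrightarrow> Ck_on k S (\<lambda>x. c)"
  by (induction k arbitrary: c) auto

lemma Ck_on_add:
  assumes "open S" "Ck_on k S f" "Ck_on k S g"
  shows "Ck_on k S (\<lambda>x. f x + g x)"
  using assms(2,3)
proof (induction k arbitrary: f g)
  case 0
  then show ?case by (auto intro: continuous_intros)
next
  case (Suc k)
  show ?case
    by (rule Ck_on_SucI[OF assms(1) has_derivative_add[OF has_derivative_frechet has_derivative_frechet]])
      (use Suc in auto)
qed

lemma Ck_on_sum:
  assumes "open S" "\<And>i. i \<in> I \<Longrightarrow> Ck_on k S (f i)"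
  shows "Ck_on k S (\<lambda>x. \<Sum>i\<in>I. f i x)"
  using assms(2)
  by (induction I rule: infinite_finite_induct) (auto simp: Ck_on_const Ck_on_add assms(1))

lemma Ck_on_inner_left:
  assumes "open S" "Ck_on k S f"
  shows "Ck_on k S (\<lambda>x. f x \<bullet> b)"
  using assms(2)
proof (induction k arbitrary: f)
  case 0
  then show ?case by (auto intro: continuous_intros)
next
  case (Suc k)
  show ?case
    by (rule Ck_on_SucI[OF assms(1) has_derivative_inner_left[OF has_derivative_frechet]])
      (use Suc in auto)
qed

lemma Ck_on_scaleR:
  assumes "open S" "Ck_on k S f" "Ck_on k S g"
  shows "Ck_on k S (\<lambda>x. f x *\<^sub>R g x)"
  using assms(2,3)
proof (induction k arbitrary: f g)
  case 0
  then show ?case by (auto intro: continuous_intros)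
next
  case (Suc k)
  \<comment> \<open>The product rule leaves one factor undifferentiated, so the factors themselves
    are needed at order \<open>k\<close> too.\<close>
  have "Ck_on k S f" "Ck_on k S g"
    using Suc.prems by (auto intro: Ck_on_mono_order simp del: Ck_on.simps)
  then have "Ck_on k S (\<lambda>x. f x *\<^sub>R frechet_derivative g (at x) v + frechet_derivative f (at x) v *\<^sub>R g x)" for v
    using Suc by (auto intro!: Ck_on_add assms(1) Suc.IH)
  then show ?case
    by (intro Ck_on_SucI[OF assms(1) has_derivative_scaleR[OF has_derivative_frechet has_derivative_frechet]])
      (use Suc.prems in auto)
qed

text \<open>Along a solution of u' = f(u) this is the time derivative of F(u), so the
  \<open>k\<close>-th iterate applied to \<open>f\<close> gives the derivative of order k + 1 of
  \<open>u\<close>. The field used by the method is the case k = 1.\<close>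

definition lie_derivative :: "('a::euclidean_space \<Rightarrow> 'a) \<Rightarrow> ('a \<Rightarrow> 'b::euclidean_space) \<Rightarrow> 'a \<Rightarrow> 'b" where
  "lie_derivative f F x = frechet_derivative F (at x) (f x)"

text \<open>\<open>Ck_on\<close> controls derivatives in fixed directions, whereas the direction
  \<open>f x\<close> moves with \<open>x\<close>. Expanding \<open>f x\<close> in the basis reduces
  the moving direction to products of smooth functions.\<close>

lemma Ck_on_lie_derivative:
  assumes "open S" "Ck_on k S f" "Ck_on (Suc k) S F"
  shows "Ck_on k S (lie_derivative f F)"
proof (rule Ck_on_cong[OF assms(1)])
  show "Ck_on k S (\<lambda>x. \<Sum>b\<in>Basis. (f x \<bullet> b) *\<^sub>R frechet_derivative F (at x) b)"
    using assms by (intro Ck_on_sum Ck_on_scaleR Ck_on_inner_left) auto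
next
  fix x assume "x \<in> S"
  then interpret D: linear "frechet_derivative F (at x)"
    using has_derivative_frechet[OF assms(3)] has_derivative_linear by blast
  have "lie_derivative f F x = frechet_derivative F (at x) (\<Sum>b\<in>Basis. (f x \<bullet> b) *\<^sub>R b)"
    by (simp add: lie_derivative_def euclidean_representation)
  then show "(\<Sum>b\<in>Basis. (f x \<bullet> b) *\<^sub>R frechet_derivative F (at x) b) = lie_derivative f F x"
    by (simp only: D.sum D.scale)
qed

lemma Ck_on_lie_derivative_iterate:
  assumes "open S" "Ck_on n S f" "k \<le> n"
  shows "Ck_on (n - k) S ((lie_derivative f ^^ k) f)"
  using assms(3)
proof (induction k)
  case 0
  then show ?case using assms by simp
next
  case (Suc k)
  then have "Ck_on (Suc (n - Suc k)) S ((lie_derivative f ^^ k) f)"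
    by (simp add: Suc_diff_Suc del: Ck_on.simps)
  moreover have "Ck_on (n - Suc k) S f"
    using assms(2) Ck_on_le diff_le_self by blast
  ultimately show ?case
    by (simp add: Ck_on_lie_derivative assms(1) del: Ck_on.simps)
qed

lemma has_vector_derivative_along_solution:
  assumes "Ck_on (Suc k) S F" "u t \<in> S" "(u has_vector_derivative f (u t)) (at t within A)"
  shows "((\<lambda>t. F (u t)) has_vector_derivative lie_derivative f F (u t)) (at t within A)"
proof -
  have F: "(F has_derivative frechet_derivative F (at (u t))) (at (u t))"
    by (rule has_derivative_frechet[OF assms(1,2)])
  interpret D: linear "frechet_derivative F (at (u t))"
    using F by (rule has_derivative_linear)
  from has_derivative_compose[OF assms(3)[unfolded has_vector_derivative_def] F]
  show ?thesis by (simp add: has_vector_derivative_def lie_derivative_def D.scale)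
qed

section \<open>Quantitative estimates\<close>

text \<open>Each directional derivative is continuous, hence bounded on a compact set; summing the
  bounds over the basis controls the operator norm.\<close>

lemma C1_bounded_derivative:
  fixes F :: "'a::euclidean_space \<Rightarrow> 'b::euclidean_space"
  assumes "Ck_on 1 S F" "compact K" "K \<subseteq> S"
  obtains L where "L > 0" "\<And>x. x \<in> K \<Longrightarrow> onorm (frechet_derivative F (at x)) \<le> L"
proof -
  have "\<exists>B. \<forall>x\<in>K. norm (frechet_derivative F (at x) b) \<le> B" for b
  proof -
    have "continuous_on K (\<lambda>x. frechet_derivative F (at x) b)"
      using assms by (auto intro: continuous_on_subset[of S])
    then show ?thesis
      using compact_continuous_image[OF _ assms(2)] compact_imp_bounded
      by (fastforce simp: bounded_iff)
  qed
  then obtain B where B: "\<And>x b. x \<in> K \<Longrightarrow> norm (frechet_derivative F (at x) b) \<le> B b"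
    by metis
  have "onorm (frechet_derivative F (at x)) \<le> max 1 (\<Sum>b\<in>Basis. B b)" if "x \<in> K" for x
  proof (rule onorm_le)
    fix v
    interpret D: linear "frechet_derivative F (at x)"
      using has_derivative_linear[OF has_derivative_frechet[of 0 S F x]] assms(1,3) that by auto
    have "norm (frechet_derivative F (at x) v) = norm (\<Sum>b\<in>Basis. (v \<bullet> b) *\<^sub>R frechet_derivative F (at x) b)"
      using D.sum[of "\<lambda>b. (v \<bullet> b) *\<^sub>R b" Basis] by (simp add: D.scale euclidean_representation)
    also have "\<dots> \<le> (\<Sum>b\<in>Basis. norm v * B b)"
      by (intro sum_norm_le) (auto intro!: mult_mono B that Basis_le_norm)
    also have "\<dots> \<le> max 1 (\<Sum>b\<in>Basis. B b) * norm v"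
      using mult_left_mono[of "\<Sum>b\<in>Basis. B b" "max 1 (\<Sum>b\<in>Basis. B b)" "norm v"]
      by (simp add: sum_distrib_left mult.commute)
    finally show "norm (frechet_derivative F (at x) v) \<le> max 1 (\<Sum>b\<in>Basis. B b) * norm v" .
  qed
  then show ?thesis using that[of "max 1 (\<Sum>b\<in>Basis. B b)"] by auto
qed

lemma C1_lipschitz_on_cball:
  fixes F :: "'a::euclidean_space \<Rightarrow> 'b::euclidean_space"
  assumes "Ck_on 1 S F" "cball p r \<subseteq> S"
  obtains L where "L > 0" "\<And>x y. x \<in> cball p r \<Longrightarrow> y \<in> cball p r \<Longrightarrow> norm (F x - F y) \<le> L * norm (x - y)"
proof -
  obtain L where "L > 0" and L: "\<And>x. x \<in> cball p r \<Longrightarrow> onorm (frechet_derivative F (at x)) \<le> L"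
    using C1_bounded_derivative[OF assms(1) _ assms(2)] by auto
  have "norm (F x - F y) \<le> L * norm (x - y)" if "x \<in> cball p r" "y \<in> cball p r" for x y
  proof (rule differentiable_bound[where f = F and f' = "\<lambda>x. frechet_derivative F (at x)" and S = "cball p r"])
    show "(F has_derivative frechet_derivative F (at z)) (at z within cball p r)" if "z \<in> cball p r" for z
      using has_derivative_frechet[of 0 S F z] assms(1) subsetD[OF assms(2) that]
      by (simp add: has_derivative_at_withinI)
  qed (fact convex_cball L that)+
  then show ?thesis using \<open>L > 0\<close> that by blast
qed

text \<open>Mean value inequality for \<open>F\<close> minus its linearization at \<open>p\<close>:
  the derivative of the difference is O(\<open>\<rho>\<close>) on the ball of radius
  \<open>\<rho>\<close>. That \<open>K\<close> does not depend on \<open>\<rho>\<close> matters,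
  because the radius will shrink with the step size.\<close>

lemma C2_linearization_on_cball:
  fixes F :: "'a::euclidean_space \<Rightarrow> 'b::euclidean_space"
  assumes "Ck_on 2 S F" "cball p r \<subseteq> S"
  obtains K where "K > 0"
    "\<And>x y \<rho>. x \<in> cball p \<rho> \<Longrightarrow> y \<in> cball p \<rho> \<Longrightarrow> \<rho> \<le> r \<Longrightarrow>
       norm (F x - F y - frechet_derivative F (at p) (x - y)) \<le> K * \<rho> * norm (x - y)"
proof -
  let ?D = "\<lambda>x. frechet_derivative F (at x)"
  have "\<exists>L>0. \<forall>x\<in>cball p r. \<forall>y\<in>cball p r. norm (?D x v - ?D y v) \<le> L * norm (x - y)" for v
  proof -
    have "Ck_on 1 S (\<lambda>x. ?D x v)" using assms(1) by (simp add: numeral_2_eq_2)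
    from C1_lipschitz_on_cball[OF this assms(2)] show ?thesis by metis
  qed
  then obtain L where L0: "\<And>v. L v > 0"
    and L: "\<And>v x y. x\<in>cball p r \<Longrightarrow> y\<in>cball p r \<Longrightarrow> norm (?D x v - ?D y v) \<le> L v * norm (x - y)"
    by metis
  define K where "K = 1 + (\<Sum>b\<in>Basis. L b)"
  have "K > 0" unfolding K_def by (intro add_pos_nonneg sum_nonneg less_imp_le[OF L0]) simp
  have der: "(F has_derivative ?D x) (at x)" if "x \<in> cball p r" for x
    using has_derivative_frechet[of 1 S F] that assms by (auto simp: numeral_2_eq_2)
  have "norm (F x - F y - ?D p (x - y)) \<le> K * \<rho> * norm (x - y)"
    if x: "x \<in> cball p \<rho>" and y: "y \<in> cball p \<rho>" and "\<rho> \<le> r" for x y \<rho>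
  proof -
    have "\<rho> \<ge> 0" using x by (auto intro: order_trans[OF zero_le_dist])
    then have p: "p \<in> cball p r" using \<open>\<rho> \<le> r\<close> by simp
    have lin: "linear (?D z)" if "z \<in> cball p r" for z
      using der[OF that] has_derivative_linear by blast
    have on: "onorm (\<lambda>v. ?D z v - ?D p v) \<le> K * \<rho>" if z: "z \<in> cball p \<rho>" for z
    proof (rule onorm_le)
      fix v
      have zr: "z \<in> cball p r" using z \<open>\<rho> \<le> r\<close> by auto
      interpret D: linear "\<lambda>v. ?D z v - ?D p v"
        by (intro linear_compose_sub lin zr p)
      have "norm (?D z v - ?D p v) = norm (\<Sum>b\<in>Basis. (v \<bullet> b) *\<^sub>R (?D z b - ?D p b))"
        using D.sum[of "\<lambda>b. (v \<bullet> b) *\<^sub>R b" Basis] D.scale by (simp add: euclidean_representation)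
      also have "\<dots> \<le> (\<Sum>b\<in>Basis. norm v * (L b * \<rho>))"
      proof (rule sum_norm_le)
        fix b :: 'a assume b: "b \<in> Basis"
        have "norm (?D z b - ?D p b) \<le> L b * norm (z - p)" by (rule L[OF zr p])
        also have "\<dots> \<le> L b * \<rho>"
          using z L0[of b] by (auto simp: dist_norm norm_minus_commute)
        finally show "norm ((v \<bullet> b) *\<^sub>R (?D z b - ?D p b)) \<le> norm v * (L b * \<rho>)"
          using b by (auto intro!: mult_mono simp: Basis_le_norm)
      qed
      also have "\<dots> = (K - 1) * \<rho> * norm v"
        by (simp add: K_def sum_distrib_left sum_distrib_right mult_ac)
      also have "\<dots> \<le> K * \<rho> * norm v"
        using \<open>\<rho> \<ge> 0\<close> by (intro mult_right_mono) auto
      finally show "norm (?D z v - ?D p v) \<le> K * \<rho> * norm v" .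
    qed
    have "norm ((F x - ?D p x) - (F y - ?D p y)) \<le> K * \<rho> * norm (x - y)"
    proof (rule differentiable_bound[where f = "\<lambda>x. F x - ?D p x" and f' = "\<lambda>z v. ?D z v - ?D p v"
          and S = "cball p \<rho>"])
      fix z assume "z \<in> cball p \<rho>"
      then have zr: "z \<in> cball p r" using \<open>\<rho> \<le> r\<close> by auto
      have "bounded_linear (?D p)" using der[OF p] has_derivative_bounded_linear by blast
      then have "((\<lambda>x. ?D p x) has_derivative ?D p) (at z)" by (rule bounded_linear_imp_has_derivative)
      with der[OF zr] have "((\<lambda>x. F x - ?D p x) has_derivative (\<lambda>v. ?D z v - ?D p v)) (at z)"
        by (rule has_derivative_diff)
      then show "((\<lambda>x. F x - ?D p x) has_derivative (\<lambda>v. ?D z v - ?D p v)) (at z within cball p \<rho>)"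
        by (rule has_derivative_at_withinI)
    qed (fact convex_cball on x y)+
    moreover have "F x - F y - ?D p (x - y) = (F x - ?D p x) - (F y - ?D p y)"
      by (simp add: linear_diff[OF lin[OF p]] algebra_simps)
    ultimately show ?thesis by (simp only:)
  qed
  then show ?thesis using that \<open>K > 0\<close> by blast
qed

text \<open>Induction through the derivative: the remainder of D 0 vanishes at 0 and has the
  remainder of D 1 as derivative. The mean value inequality works for vector values and one-sided
  derivatives; each use costs a factor t instead of t/n, which is why no 1/n! appears.\<close>

lemma taylor_vector_bound:
  fixes D :: "nat \<Rightarrow> real \<Rightarrow> 'a::real_normed_vector"
  assumes "\<And>m t. m < n \<Longrightarrow> t \<in> {0..T} \<Longrightarrow> (D m has_vector_derivative D (Suc m) t) (at t within {0..T})"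
    and "\<And>t. t \<in> {0..T} \<Longrightarrow> norm (D n t) \<le> C" and "t \<in> {0..T}"
  shows "norm (D 0 t - (\<Sum>k<n. (t ^ k / fact k) *\<^sub>R D k 0)) \<le> C * t ^ n"
  using assms
proof (induction n arbitrary: D t)
  case 0
  then show ?case by simp
next
  case (Suc n)
  define R where "R = (\<lambda>s. D 0 s - (\<Sum>k<Suc n. (s ^ k / fact k) *\<^sub>R D k 0))"
  define R' where "R' = (\<lambda>s. D 1 s - (\<Sum>k<n. (s ^ k / fact k) *\<^sub>R D (Suc k) 0))"
  have bound: "norm (R' s) \<le> C * s ^ n" if "s \<in> {0..T}" for s
    using Suc.IH[of "\<lambda>k. D (Suc k)"] Suc.prems that by (simp add: R'_def)
  have "C \<ge> 0" using Suc.prems(2)[OF Suc.prems(3)] norm_ge_zero order_trans by blast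
  have R_deriv: "(R has_vector_derivative R' s) (at s within {0..t})" if "s \<in> {0..t}" for s
  proof -
    have poly: "((\<lambda>s. (s ^ Suc k / fact (Suc k)) *\<^sub>R D (Suc k) 0) has_vector_derivative
        (s ^ k / fact k) *\<^sub>R D (Suc k) 0) (at s within {0..t})" for k
    proof -
      have "((\<lambda>s. s ^ Suc k / fact (Suc k)) has_real_derivative
          (1 + real k) * s ^ k / ((1 + real k) * fact k)) (at s within {0..t})"
        by (auto intro!: derivative_eq_intros simp del: power_Suc)
      then have "((\<lambda>s. s ^ Suc k / fact (Suc k)) has_vector_derivative s ^ k / fact k) (at s within {0..t})"
        by (simp add: has_real_derivative_iff_has_vector_derivative add_eq_0_iff del: power_Suc)
      then show ?thesis by (rule bounded_linear.has_vector_derivative[OF bounded_linear_scaleR_left])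
    qed
    have "(D 0 has_vector_derivative D (Suc 0) s) (at s within {0..t})"
      using Suc.prems(1)[of 0 s] that Suc.prems(3)
      by (auto intro: has_vector_derivative_within_subset[of _ _ _ "{0..T}"])
    then have "((\<lambda>s. D 0 s - (\<Sum>k<n. (s ^ Suc k / fact (Suc k)) *\<^sub>R D (Suc k) 0) - D 0 0)
        has_vector_derivative D (Suc 0) s - (\<Sum>k<n. (s ^ k / fact k) *\<^sub>R D (Suc k) 0) - 0) (at s within {0..t})"
      by (intro has_vector_derivative_diff has_vector_derivative_sum poly has_vector_derivative_const)
    then show ?thesis
      by (simp add: R_def R'_def sum.lessThan_Suc_shift diff_diff_eq add.commute del: sum.lessThan_Suc power_Suc fact_Suc)
  qed
  have R'_bound: "norm (R' s) \<le> C * t ^ n" if "s \<in> {0..t}" for s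
    using bound[of s] that Suc.prems(3) \<open>C \<ge> 0\<close> by (auto elim!: order_trans intro!: mult_left_mono power_mono)
  have "norm (R t - R 0) \<le> (C * t ^ n) * norm (t - 0)"
  proof (rule differentiable_bound[where f = R and S = "{0..t}" and f' = "\<lambda>s v. v *\<^sub>R R' s"])
    show "onorm (\<lambda>v. v *\<^sub>R R' s) \<le> C * t ^ n" if "s \<in> {0..t}" for s
      using R'_bound[OF that] by (intro onorm_le) (simp add: mult.commute mult_left_mono)
  qed (use Suc.prems(3) R_deriv in \<open>auto simp: has_vector_derivative_def\<close>)
  moreover have "R 0 = 0"
    by (simp add: R_def sum.lessThan_Suc_shift del: sum.lessThan_Suc)
  ultimately show ?case using Suc.prems(3) by (simp add: R_def mult_ac del: sum.lessThan_Suc)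
qed

section \<open>Vector-valued order terms as the step size tends to zero\<close>

text \<open>Taking the norm inside the definition gives scalar coefficients and vector-valued stage
  errors one common calculus. Only h > 0 is considered, as in the definition of consistency.\<close>

definition bigoh :: "nat \<Rightarrow> (real \<Rightarrow> 'a::real_normed_vector) \<Rightarrow> bool" where
  "bigoh n u \<longleftrightarrow> (\<exists>C. \<forall>\<^sub>F h in at_right 0. norm (u h) \<le> C * h ^ n)"

lemma eventually_at_right_0_pos: "\<forall>\<^sub>F h::real in at_right 0. h > 0"
  by (simp add: eventually_at_right_less)

lemma bigohE:
  assumes "bigoh n u"
  obtains C where "C > 0" "\<forall>\<^sub>F h in at_right 0. norm (u h) \<le> C * h ^ n"
proof -
  obtain C where C: "\<forall>\<^sub>F h in at_right 0. norm (u h) \<le> C * h ^ n"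
    using assms by (auto simp: bigoh_def)
  have "\<forall>\<^sub>F h in at_right 0. norm (u h) \<le> max 1 C * h ^ n"
    using C eventually_at_right_0_pos
    by eventually_elim (auto elim!: order_trans intro!: mult_right_mono)
  then show ?thesis using that[of "max 1 C"] by auto
qed

text \<open>The bridge to Landau symbols, in which the scalar expansions are computed and
  consistency is stated.\<close>

lemma bigoh_iff_landau: "bigoh n u \<longleftrightarrow> (\<lambda>h. norm (u h)) \<in> O[at_right 0](\<lambda>h. h ^ n)"
proof
  assume "bigoh n u"
  then obtain C where "\<forall>\<^sub>F h in at_right 0. norm (u h) \<le> C * h ^ n" by (elim bigohE)
  then have "\<forall>\<^sub>F h in at_right 0. norm (norm (u h)) \<le> C * norm (h ^ n)"
    using eventually_at_right_0_pos by eventually_elim simp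
  then show "(\<lambda>h. norm (u h)) \<in> O[at_right 0](\<lambda>h. h ^ n)" by (rule bigoI)
next
  assume "(\<lambda>h. norm (u h)) \<in> O[at_right 0](\<lambda>h. h ^ n)"
  then obtain C where "\<forall>\<^sub>F h in at_right 0. norm (norm (u h)) \<le> C * norm (h ^ n)"
    by (elim landau_o.bigE)
  then have "\<forall>\<^sub>F h in at_right 0. norm (u h) \<le> C * h ^ n"
    using eventually_at_right_0_pos by eventually_elim simp
  then show "bigoh n u" by (auto simp: bigoh_def)
qed

lemma bigoh_realI: "u \<in> O[at_right 0](\<lambda>h. h ^ n) \<Longrightarrow> bigoh n u" for u :: "real \<Rightarrow> real"
  by (simp add: bigoh_iff_landau)

text \<open>Eventual equality suffices, and it is all that the closed forms of the coefficients and
  the stage equations provide.\<close>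

lemma bigoh_cong:
  assumes "bigoh n u" "\<forall>\<^sub>F h in at_right 0. v h = u h"
  shows "bigoh n v"
proof -
  obtain C where "\<forall>\<^sub>F h in at_right 0. norm (u h) \<le> C * h ^ n"
    using assms(1) by (auto simp: bigoh_def)
  then have "\<forall>\<^sub>F h in at_right 0. norm (v h) \<le> C * h ^ n"
    using assms(2) by eventually_elim simp
  then show ?thesis by (auto simp: bigoh_def)
qed

lemma bigoh_add: "bigoh n u \<Longrightarrow> bigoh n v \<Longrightarrow> bigoh n (\<lambda>h. u h + v h)"
proof (elim bigohE)
  fix C D assume C: "\<forall>\<^sub>F h in at_right 0. norm (u h) \<le> C * h ^ n"
    and D: "\<forall>\<^sub>F h in at_right 0. norm (v h) \<le> D * h ^ n"
  have "\<forall>\<^sub>F h in at_right 0. norm (u h + v h) \<le> (C + D) * h ^ n"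
    using C D by eventually_elim (auto simp: distrib_right intro: norm_triangle_le add_mono)
  then show ?thesis by (auto simp: bigoh_def)
qed

lemma bigoh_minus: "bigoh n u \<Longrightarrow> bigoh n (\<lambda>h. - u h)"
  by (simp add: bigoh_def)

lemma bigoh_diff: "bigoh n u \<Longrightarrow> bigoh n v \<Longrightarrow> bigoh n (\<lambda>h. u h - v h)"
  using bigoh_add[of n u "\<lambda>h. - v h"] bigoh_minus[of n v] by simp

lemma bigoh_scaleR:
  assumes "bigoh m u" "bigoh n v"
  shows "bigoh (m + n) (\<lambda>h. u h *\<^sub>R v h)"
proof -
  obtain C where C: "C > 0" "\<forall>\<^sub>F h in at_right 0. norm (u h) \<le> C * h ^ m" using assms(1) by (rule bigohE)
  obtain D where D: "D > 0" "\<forall>\<^sub>F h in at_right 0. norm (v h) \<le> D * h ^ n" using assms(2) by (rule bigohE)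
  have "\<forall>\<^sub>F h in at_right 0. norm (u h *\<^sub>R v h) \<le> (C * D) * h ^ (m + n)"
    using C(2) D(2) eventually_at_right_0_pos
  proof eventually_elim
    case (elim h)
    then have "norm (u h) * norm (v h) \<le> (C * h ^ m) * (D * h ^ n)"
      using C(1) by (intro mult_mono) auto
    then show ?case by (simp add: power_add mult_ac)
  qed
  then show ?thesis by (auto simp: bigoh_def)
qed

lemma bigoh_mult: "bigoh m u \<Longrightarrow> bigoh n v \<Longrightarrow> bigoh (m + n) (\<lambda>h. u h * v h)" for u v :: "real \<Rightarrow> real"
  using bigoh_scaleR[of m u n v] by simp

lemma bigoh_const: "bigoh 0 (\<lambda>h. c)"
  by (auto simp: bigoh_def)

lemma bigoh_power: "bigoh n (\<lambda>h::real. h ^ n)"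
  by (rule bigoh_realI) simp

lemma bigoh_le:
  assumes "bigoh m u" "n \<le> m"
  shows "bigoh n u"
proof -
  obtain C where C: "C > 0" "\<forall>\<^sub>F h in at_right 0. norm (u h) \<le> C * h ^ m" using assms(1) by (rule bigohE)
  have "\<forall>\<^sub>F h::real in at_right 0. h < 1" by (rule eventually_at_rightI[of 0 1]) auto
  with C(2) eventually_at_right_0_pos have "\<forall>\<^sub>F h in at_right 0. norm (u h) \<le> C * h ^ n"
  proof eventually_elim
    case (elim h)
    then have "C * h ^ m \<le> C * h ^ n"
      using C(1) assms(2) by (intro mult_left_mono power_decreasing) auto
    with elim show ?case by linarith
  qed
  then show ?thesis by (auto simp: bigoh_def)
qed

lemma bigoh_scaleR_left: "bigoh n u \<Longrightarrow> bigoh n (\<lambda>h. u h *\<^sub>R v)"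
  using bigoh_scaleR[of n u 0 "\<lambda>_. v"] bigoh_const by auto

lemma bigoh_mult_left: "bigoh n u \<Longrightarrow> bigoh n (\<lambda>h. c * u h)" for u :: "real \<Rightarrow> real"
  using bigoh_mult[of 0 "\<lambda>_. c" n u] bigoh_const by auto

lemma bigoh_bounded_linear:
  assumes "bounded_linear G" "bigoh n u"
  shows "bigoh n (\<lambda>h. G (u h))"
proof -
  obtain K where K: "K > 0" "\<And>x. norm (G x) \<le> norm x * K"
    using bounded_linear.pos_bounded[OF assms(1)] by blast
  obtain C where C: "\<forall>\<^sub>F h in at_right 0. norm (u h) \<le> C * h ^ n" using assms(2) by (rule bigohE)
  have "\<forall>\<^sub>F h in at_right 0. norm (G (u h)) \<le> (C * K) * h ^ n"
    using C
  proof eventually_elim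
    case (elim h)
    then have "norm (u h) * K \<le> (C * h ^ n) * K" using K(1) by (intro mult_right_mono) auto
    then show ?case using K(2)[of "u h"] by (simp add: mult_ac)
  qed
  then show ?thesis by (auto simp: bigoh_def)
qed

lemma filterlim_scale_at_right_0: "c > 0 \<Longrightarrow> filterlim (\<lambda>h. c * h) (at_right 0) (at_right (0::real))"
  by real_asymp

lemma bigoh_rescale:
  assumes "bigoh n u" "c > 0"
  shows "bigoh n (\<lambda>h. u (c * h))"
proof -
  obtain C where "\<forall>\<^sub>F h in at_right 0. norm (u h) \<le> C * h ^ n" using assms(1) by (rule bigohE)
  then have "\<forall>\<^sub>F h in at_right 0. norm (u (c * h)) \<le> C * (c * h) ^ n"
    using filterlim_scale_at_right_0[OF assms(2)] by (rule eventually_compose_filterlim)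
  then have "\<forall>\<^sub>F h in at_right 0. norm (u (c * h)) \<le> (C * c ^ n) * h ^ n"
    by (simp add: power_mult_distrib mult_ac)
  then show ?thesis by (auto simp: bigoh_def)
qed

lemma bigoh_imp_tendsto_0:
  assumes "bigoh n u" "n > 0"
  shows "(u \<longlongrightarrow> 0) (at_right 0)"
proof -
  obtain C where C: "\<forall>\<^sub>F h in at_right 0. norm (u h) \<le> C * h ^ n" using assms(1) by (rule bigohE)
  have "((\<lambda>h. C * h ^ n) \<longlongrightarrow> C * 0 ^ n) (at_right 0)"
    by (intro tendsto_intros)
  then have "((\<lambda>h. C * h ^ n) \<longlongrightarrow> 0) (at_right 0)"
    using assms(2) by (simp only: zero_power mult_zero_right)
  then show ?thesis by (rule Lim_null_comparison[OF C])
qed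

section \<open>Expansions of the coefficients\<close>

text \<open>The expansion is computed at unit scale; \<open>bigoh_rescale\<close> then inserts the
  node. The expansions below, up to the cosine and sine quotients, follow the same pattern.\<close>

lemma sin_over_expansion: "bigoh 4 (\<lambda>t::real. sin (c * t) / t - c + c ^ 3 * t\<^sup>2 / 6)" if "c > 0"
proof -
  have "bigoh 4 (\<lambda>t::real. sin t / t - 1 + t\<^sup>2 / 6)"
    by (rule bigoh_realI) real_asymp
  from bigoh_mult_left[OF bigoh_rescale[OF this that], of c] show ?thesis
    using that by (simp add: algebra_simps power2_eq_square power3_eq_cube)
qed

lemma cos_expansion: "bigoh 4 (\<lambda>t::real. cos (c * t) - 1 + c\<^sup>2 * t\<^sup>2 / 2)" if "c > 0"
proof -
  have "bigoh 4 (\<lambda>t::real. cos t - 1 + t\<^sup>2 / 2)"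
    by (rule bigoh_realI) real_asymp
  from bigoh_rescale[OF this that] show ?thesis by (simp add: power_mult_distrib)
qed

lemma tan_over_expansion:
  "bigoh 3 (\<lambda>t::real. sin (c * t) / (t * cos (c * t)) - (c + c ^ 3 / 3 * t\<^sup>2))" if "c > 0"
proof -
  have "bigoh 3 (\<lambda>t::real. sin t / (t * cos t) - 1 - t\<^sup>2 / 3)"
    by (rule bigoh_realI) real_asymp
  from bigoh_mult_left[OF bigoh_rescale[OF this that], of c] show ?thesis
    using that by (simp add: algebra_simps power2_eq_square power3_eq_cube)
qed

lemma sec_over_square_expansion:
  "bigoh 2 (\<lambda>t::real. (1 - cos (c * t)) / (t\<^sup>2 * cos (c * t)) - c\<^sup>2 / 2)" if "c > 0"
proof -
  have "bigoh 2 (\<lambda>t::real. (1 - cos t) / (t\<^sup>2 * cos t) - 1 / 2)"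
    by (rule bigoh_realI) real_asymp
  note scaled = bigoh_mult_left[OF bigoh_rescale[OF this that], of "c\<^sup>2"]
  have "c\<^sup>2 * ((1 - cos (c * t)) / ((c * t)\<^sup>2 * cos (c * t)) - 1 / 2) =
      (1 - cos (c * t)) / (t\<^sup>2 * cos (c * t)) - c\<^sup>2 / 2" for t
    using that by (cases "t = 0"; cases "cos (c * t) = 0") (auto simp: field_simps power_mult_distrib)
  with scaled show ?thesis by simp
qed

text \<open>The identity pq - 1 = (p - 1)(q - 1) + (p - 1) + (q - 1) separates numerator and
  denominator, so each can be rescaled by its own node.\<close>

lemma cos_quotient_expansion:
  "bigoh 2 (\<lambda>t::real. cos (d * t) / cos (c * t) - 1)" if "c > 0" "d > 0"
proof -
  have "bigoh 2 (\<lambda>t::real. cos t - 1)" "bigoh 2 (\<lambda>t::real. 1 / cos t - 1)"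
    by (rule bigoh_realI; real_asymp)+
  note D = bigoh_rescale[OF this(1) that(2)] and C = bigoh_rescale[OF this(2) that(1)]
  from bigoh_le[OF bigoh_mult[OF D C], of 2]
  have "bigoh 2 (\<lambda>t::real. (cos (d * t) - 1) * (1 / cos (c * t) - 1))" by simp
  from bigoh_add[OF bigoh_add[OF this D] C] show ?thesis
    by (simp add: left_diff_distrib right_diff_distrib diff_divide_distrib)
qed

lemma sin_quotient_expansion:
  "bigoh 2 (\<lambda>t::real. sin (d * t) / (t * cos (c * t)) - d)" if "c > 0" "d > 0"
proof -
  have "bigoh 2 (\<lambda>t::real. sin t / t - 1)" "bigoh 2 (\<lambda>t::real. 1 / cos t - 1)"
    by (rule bigoh_realI; real_asymp)+
  note D = bigoh_rescale[OF this(1) that(2)] and C = bigoh_rescale[OF this(2) that(1)]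
  from bigoh_le[OF bigoh_mult[OF D C], of 2]
  have "bigoh 2 (\<lambda>t::real. (sin (d * t) / (d * t) - 1) * (1 / cos (c * t) - 1))" by simp
  from bigoh_mult_left[OF bigoh_add[OF bigoh_add[OF this D] C], of d] show ?thesis
    using that by (simp add: left_diff_distrib right_diff_distrib distrib_left diff_divide_distrib)
qed

section \<open>Exponential fitting\<close>

lemma c1_pos: "c1 > 0" and c1_less_c2: "c1 < c2" and c2_less_1: "c2 < 1"
proof -
  have "sqrt 6 < sqrt (4\<^sup>2)" "sqrt 6 > 0" by (subst real_sqrt_less_iff) auto
  then show "c1 > 0" "c1 < c2" "c2 < 1" by (auto simp: c1_def c2_def)
qed

lemma ef_tddirk_simps [simp]:
  "node ef_tddirk (Suc 0) = c1" "node ef_tddirk 2 = c2"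
  "xicoef ef_tddirk (Suc 0) = xi1" "xicoef ef_tddirk 2 = xi2"
  "acoef ef_tddirk (Suc 0) j = a11" "acoef ef_tddirk 2 (Suc 0) = a21" "acoef ef_tddirk 2 2 = a22"
  "bcoef ef_tddirk (Suc 0) = b1" "bcoef ef_tddirk 2 = b2"
  by (simp_all add: ef_tddirk_def)

lemma atLeastAtMost_1_2: "{1..2} = {Suc 0, 2}" "{Suc 0..2} = {Suc 0, 2}"
  by auto

lemma exponentially_fitted:
  assumes "denominators_nonzero \<mu>"
  shows "exponentially_fitted_at ef_tddirk \<mu>"
proof (cases "\<mu> = 0")
  case True
  \<comment> \<open>At zero the factors \<mu> and \<mu>^2 and all right-hand sides vanish.\<close>
  then show ?thesis by (simp add: exponentially_fitted_at_def)
next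
  case False
  \<comment> \<open>In these six symbols the conditions become rational identities that hold for
    arbitrary values with nonzero denominators. Exchanging primed and unprimed symbols, together
    with \<mu> and -\<mu>, exchanges the two signs.\<close>
  define A A' B B' M M' where
    "A = exp (of_real c1 * \<mu>)" and "A' = exp (- of_real c1 * \<mu>)" and
    "B = exp (of_real c2 * \<mu>)" and "B' = exp (- of_real c2 * \<mu>)" and
    "M = exp \<mu>" and "M' = exp (- \<mu>)"
  note defs = this
  have E: "Eplus \<mu> c1 = A + A'" "Eplus \<mu> c2 = B + B'" "Eminus \<mu> c1 = A - A'" "Eminus \<mu> c2 = B - B'"
    "Eminus \<mu> (c1 - c2) = A * B' - A' * B" "Eminus \<mu> (1 - c1) = M * A' - M' * A"
    "Eminus \<mu> (1 - c2) = M * B' - M' * B"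
    by (simp_all add: Eplus_def Eminus_def defs mult_exp_exp algebra_simps)
  have nz: "A + A' \<noteq> 0" "B + B' \<noteq> 0" "A * B' - A' * B \<noteq> 0"
    using assms False unfolding denominators_nonzero_def E by auto
  have c: "complex_of_real c1 \<noteq> 0" "complex_of_real c2 \<noteq> 0"
    using c1_pos c1_less_c2 by auto
  have X1: "xi1 \<mu> * of_real c1 * \<mu> = (A - A') / (A + A')"
    using False c by (simp add: xi1_def fill_at_0_def E)
  have X2: "xi2 \<mu> * of_real c2 * \<mu> = (B - B' - of_real phi * \<mu>\<^sup>2 * (A * B' - A' * B)) / (B + B')"
    using False c by (simp add: xi2_def fill_at_0_def E)
  have A11: "\<mu>\<^sup>2 * a11 \<mu> = (A + A' - 2) / (A + A')"
    using False nz by (simp add: a11_def fill_at_0_def E diff_divide_distrib right_diff_distrib)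
  have A22: "\<mu>\<^sup>2 * a22 \<mu> = (B + B' - (2 + of_real phi * \<mu>\<^sup>2 * (A + A'))) / (B + B')"
    using False by (simp add: a22_def fill_at_0_def E)
  have B1: "\<mu>\<^sup>2 * b1 \<mu> = (B - B' + (M * B' - M' * B) - \<mu> * (B + B')) / (A * B' - A' * B)"
    using False by (simp add: b1_def fill_at_0_def E)
  have B2: "\<mu>\<^sup>2 * b2 \<mu> = (\<mu> * (A + A') - (A - A') - (M * A' - M' * A)) / (A * B' - A' * B)"
    using False by (simp add: b2_def fill_at_0_def E)
  have 1: "\<mu>\<^sup>2 * a11 \<mu> * A + xi1 \<mu> * of_real c1 * \<mu> = A - 1"
    "\<mu>\<^sup>2 * a11 \<mu> * A' - xi1 \<mu> * of_real c1 * \<mu> = A' - 1"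
    unfolding A11 X1 using nz by (simp_all add: divide_simps) (simp_all add: algebra_simps)
  have 2: "\<mu>\<^sup>2 * of_real phi * A + \<mu>\<^sup>2 * a22 \<mu> * B + xi2 \<mu> * of_real c2 * \<mu> = B - 1"
    "\<mu>\<^sup>2 * of_real phi * A' + \<mu>\<^sup>2 * a22 \<mu> * B' - xi2 \<mu> * of_real c2 * \<mu> = B' - 1"
    unfolding A22 X2 using nz by (simp_all add: divide_simps) (simp_all add: algebra_simps)
  have 3: "\<mu>\<^sup>2 * b1 \<mu> * A + \<mu>\<^sup>2 * b2 \<mu> * B = M - 1 - \<mu>"
    "\<mu>\<^sup>2 * b1 \<mu> * A' + \<mu>\<^sup>2 * b2 \<mu> * B' = M' - 1 + \<mu>"
    unfolding B1 B2 using nz(3) by (simp_all add: add_divide_distrib[symmetric] divide_eq_eq) (simp_all add: algebra_simps)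
  show ?thesis
    using 1 2 3 unfolding exponentially_fitted_at_def atLeastAtMost_1_2
    by (simp add: a21_def defs algebra_simps atLeastAtMost_1_2)
qed

section \<open>The coefficients for real step sizes\<close>

text \<open>On the imaginary axis the exponential sums become cosines and sines. Each
  \<open>Eminus\<close> and each odd power of \<mu> contributes a factor i, and in all coefficients
  these factors combine to real values.\<close>

lemma Eplus_imaginary: "Eplus (\<i> * of_real t) c = of_real (2 * cos (c * t))"
  by (simp add: complex_eq_iff Eplus_def Re_exp Im_exp)

lemma Eminus_imaginary: "Eminus (\<i> * of_real t) c = \<i> * of_real (2 * sin (c * t))"
  by (simp add: complex_eq_iff Eminus_def Re_exp Im_exp)

context
  fixes t :: real
  assumes t: "t \<noteq> 0" "cos (c1 * t) \<noteq> 0" "cos (c2 * t) \<noteq> 0" "sin ((c2 - c1) * t) \<noteq> 0"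
begin

lemma xi1_imaginary:
  "xi1 (\<i> * of_real t) = of_real (sin (c1 * t) / (t * cos (c1 * t)) / c1)"
  using t c1_pos by (simp add: xi1_def fill_at_0_def Eplus_imaginary Eminus_imaginary field_simps)

lemma xi2_imaginary:
  "xi2 (\<i> * of_real t) = of_real ((sin (c2 * t) / (t * cos (c2 * t))
     - phi * t\<^sup>2 * (sin ((c2 - c1) * t) / (t * cos (c2 * t)))) / c2)"
proof -
  \<comment> \<open>The difference is reversed because the rescaled expansions require a positive
    scale factor.\<close>
  have "(c1 - c2) * t = - ((c2 - c1) * t)" by (simp add: algebra_simps)
  then have "sin ((c1 - c2) * t) = - sin ((c2 - c1) * t)" by (simp only: sin_minus)
  then show ?thesis
    using t c1_pos c1_less_c2
    by (simp add: xi2_def fill_at_0_def Eplus_imaginary Eminus_imaginary field_simps)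
qed

lemma a11_imaginary:
  "a11 (\<i> * of_real t) = of_real ((1 - cos (c1 * t)) / (t\<^sup>2 * cos (c1 * t)))"
  using t by (simp add: a11_def fill_at_0_def Eplus_imaginary field_simps)

lemma a22_imaginary:
  "a22 (\<i> * of_real t) =
     of_real ((1 - cos (c2 * t)) / (t\<^sup>2 * cos (c2 * t)) - phi * (cos (c1 * t) / cos (c2 * t)))"
  using t by (simp add: a22_def fill_at_0_def Eplus_imaginary field_simps)

lemma b1_imaginary:
  "b1 (\<i> * of_real t) =
     of_real ((sin (c2 * t) + sin ((1 - c2) * t) - t * cos (c2 * t)) / (t\<^sup>2 * sin ((c2 - c1) * t)))"
proof -
  have "(c1 - c2) * t = - ((c2 - c1) * t)" by (simp add: algebra_simps)
  then have "sin ((c1 - c2) * t) = - sin ((c2 - c1) * t)" by (simp only: sin_minus)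
  then show ?thesis
    using t by (simp add: b1_def fill_at_0_def Eplus_imaginary Eminus_imaginary divide_simps)
      (simp add: algebra_simps)
qed

lemma b2_imaginary:
  "b2 (\<i> * of_real t) =
     of_real ((t * cos (c1 * t) - sin (c1 * t) - sin ((1 - c1) * t)) / (t\<^sup>2 * sin ((c2 - c1) * t)))"
proof -
  have "(c1 - c2) * t = - ((c2 - c1) * t)" by (simp add: algebra_simps)
  then have "sin ((c1 - c2) * t) = - sin ((c2 - c1) * t)" by (simp only: sin_minus)
  then show ?thesis
    using t by (simp add: b2_def fill_at_0_def Eplus_imaginary Eminus_imaginary divide_simps)
      (simp add: algebra_simps)
qed

text \<open>Real and imaginary parts of the fitting condition for the weights, divided by -t^2 and
  -t^3. These two linear equations replace the closed forms when the weights are expanded.\<close>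

lemma fitted_quadrature_imaginary:
  "Re (b1 (\<i> * of_real t)) * cos (c1 * t) + Re (b2 (\<i> * of_real t)) * cos (c2 * t) = (1 - cos t) / t\<^sup>2"
  "Re (b1 (\<i> * of_real t)) * (sin (c1 * t) / t) + Re (b2 (\<i> * of_real t)) * (sin (c2 * t) / t)
     = (t - sin t) / t ^ 3"
proof -
  have "(c1 - c2) * t = - ((c2 - c1) * t)" by (simp add: algebra_simps)
  then have "sin ((c1 - c2) * t) = - sin ((c2 - c1) * t)" by (simp only: sin_minus)
  then have "denominators_nonzero (\<i> * of_real t)"
    using t by (simp add: denominators_nonzero_def Eplus_imaginary Eminus_imaginary)
  from exponentially_fitted[OF this]
  have "(\<i> * of_real t)\<^sup>2 * (b1 (\<i> * of_real t) * exp (of_real c1 * (\<i> * of_real t))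
      + b2 (\<i> * of_real t) * exp (of_real c2 * (\<i> * of_real t))) = exp (\<i> * of_real t) - 1 - \<i> * of_real t"
    by (simp add: exponentially_fitted_at_def atLeastAtMost_1_2)
  \<comment> \<open>The weights are real, so taking real and imaginary parts acts on the
    exponentials only.\<close>
  moreover have "b1 (\<i> * of_real t) = of_real (Re (b1 (\<i> * of_real t)))"
    "b2 (\<i> * of_real t) = of_real (Re (b2 (\<i> * of_real t)))"
    by (simp_all add: b1_imaginary b2_imaginary)
  ultimately have eq: "(\<i> * of_real t)\<^sup>2 * (of_real (Re (b1 (\<i> * of_real t))) * exp (of_real c1 * (\<i> * of_real t))
      + of_real (Re (b2 (\<i> * of_real t))) * exp (of_real c2 * (\<i> * of_real t))) = exp (\<i> * of_real t) - 1 - \<i> * of_real t"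
    by metis
  show "Re (b1 (\<i> * of_real t)) * cos (c1 * t) + Re (b2 (\<i> * of_real t)) * cos (c2 * t) = (1 - cos t) / t\<^sup>2"
    using arg_cong[OF eq, of Re] t
    by (simp add: power_mult_distrib Re_exp Im_exp field_simps)
  show "Re (b1 (\<i> * of_real t)) * (sin (c1 * t) / t) + Re (b2 (\<i> * of_real t)) * (sin (c2 * t) / t)
     = (t - sin t) / t ^ 3"
  proof -
    have "t\<^sup>2 * (Re (b1 (\<i> * of_real t)) * sin (c1 * t) + Re (b2 (\<i> * of_real t)) * sin (c2 * t)) = t - sin t"
      using arg_cong[OF eq, of Im] by (simp add: power_mult_distrib Im_exp Re_exp algebra_simps)
    then have "(t - sin t) / t ^ 3 =
        t\<^sup>2 * (Re (b1 (\<i> * of_real t)) * sin (c1 * t) + Re (b2 (\<i> * of_real t)) * sin (c2 * t)) / t ^ 3"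
      by simp
    also have "\<dots> = Re (b1 (\<i> * of_real t)) * (sin (c1 * t) / t) + Re (b2 (\<i> * of_real t)) * (sin (c2 * t) / t)"
      using t(1) by (simp add: power2_eq_square power3_eq_cube add_divide_distrib)
    finally show ?thesis by simp
  qed
qed

end

text \<open>The proviso that the step be small enough for the denominators, in eventual
  form.\<close>

lemma eventually_nondegenerate:
  "\<forall>\<^sub>F t::real in at_right 0. t \<noteq> 0 \<and> cos (c1 * t) \<noteq> 0 \<and> cos (c2 * t) \<noteq> 0 \<and> sin ((c2 - c1) * t) \<noteq> 0"
proof -
  have cos: "\<forall>\<^sub>F t::real in at_right 0. cos (c * t) > 0" if "c > 0" for c :: real
    using that by real_asymp
  have sin: "\<forall>\<^sub>F t::real in at_right 0. sin (c * t) > 0" if "c > 0" for c :: real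
    using that by real_asymp
  have "c2 > 0" "c2 - c1 > 0" using c1_pos c1_less_c2 by auto
  from cos[OF c1_pos] cos[OF this(1)] sin[OF this(2)] eventually_at_right_0_pos
  show ?thesis by eventually_elim auto
qed

text \<open>\<open>b1_0\<close> and \<open>b2_0\<close> solve the two lowest moment equations for
  the given nodes; they turn out to be the limits of the weights as the step tends to zero.\<close>

definition b1_0 :: real where "b1_0 = (c2 / 2 - 1 / 6) / (c2 - c1)"
definition b2_0 :: real where "b2_0 = (1 / 6 - c1 / 2) / (c2 - c1)"

text \<open>The first two equations define the weights. Both nodes are roots of x^2 - (4/5) x +
  1/10, so the moments obey m_(k+2) = (4/5) m_(k+1) - (1/10) m_k, and 1/2, 1/6 are continued by
  1/12, 1/20. The last equation determines \<open>phi\<close>.\<close>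

lemma limit_order_conditions:
  "b1_0 + b2_0 = 1 / 2" "b1_0 * c1 + b2_0 * c2 = 1 / 6"
  "b1_0 * c1\<^sup>2 + b2_0 * c2\<^sup>2 = 1 / 12" "b1_0 * c1 ^ 3 + b2_0 * c2 ^ 3 = 1 / 20"
  "b2_0 * (phi * (c2 - c1)) = 1 / 60"
proof -
  have d: "c2 - c1 \<noteq> 0" using c1_less_c2 by simp
  have nodes: "c1 + c2 = 4 / 5" "c1 * c2 = 1 / 10"
    by (simp_all add: c1_def c2_def field_simps)
  have "b1_0 + b2_0 = ((c2 - c1) / 2) / (c2 - c1)"
    unfolding b1_0_def b2_0_def add_divide_distrib[symmetric]
    by (rule arg_cong[of _ _ "\<lambda>x. x / (c2 - c1)"]) (simp add: field_simps)
  with d show 0: "b1_0 + b2_0 = 1 / 2" by simp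
  have "b1_0 * c1 + b2_0 * c2 = ((c2 - c1) / 6) / (c2 - c1)"
    unfolding b1_0_def b2_0_def times_divide_eq_left add_divide_distrib[symmetric]
    by (rule arg_cong[of _ _ "\<lambda>x. x / (c2 - c1)"]) (simp add: field_simps)
  with d show 1: "b1_0 * c1 + b2_0 * c2 = 1 / 6" by simp
  have "b1_0 * c1\<^sup>2 + b2_0 * c2\<^sup>2 = (c1 + c2) * (b1_0 * c1 + b2_0 * c2) - c1 * c2 * (b1_0 + b2_0)"
    by (simp add: power2_eq_square algebra_simps)
  then show 2: "b1_0 * c1\<^sup>2 + b2_0 * c2\<^sup>2 = 1 / 12" unfolding nodes 0 1 by simp
  have "b1_0 * c1 ^ 3 + b2_0 * c2 ^ 3 = (c1 + c2) * (b1_0 * c1\<^sup>2 + b2_0 * c2\<^sup>2) - c1 * c2 * (b1_0 * c1 + b2_0 * c2)"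
    by (simp add: power2_eq_square power3_eq_cube algebra_simps)
  then show "b1_0 * c1 ^ 3 + b2_0 * c2 ^ 3 = 1 / 20" unfolding nodes 1 2 by simp
  have "b2_0 * (phi * (c2 - c1)) = (1 / 6 - c1 / 2) * phi"
    using d by (simp add: b2_0_def)
  \<comment> \<open>Here 1/6 - c1/2 = (3 sqrt 6 - 2)/60, and (3 sqrt 6 - 2)(3 sqrt 6 + 2) =
    50.\<close>
  also have "\<dots> = 1 / 60"
    by (simp add: c1_def phi_def field_simps)
  finally show "b2_0 * (phi * (c2 - c1)) = 1 / 60" .
qed

text \<open>With \<open>b\<^sub>i\<close> bounded, the fitting conditions for the quadrature determine both moments up to
  \<open>t\<^sup>2\<close>, hence \<open>b\<^sub>i\<close> up to \<open>t\<^sup>2\<close>; reinserting this gains two more orders because the limit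
  weights also integrate the monomials of degree 2 and 3 exactly.\<close>

lemma quadrature_weights_expansion:
  fixes \<beta>1 \<beta>2 :: "real \<Rightarrow> real"
  defines "\<beta>1 \<equiv> \<lambda>t. Re (b1 (\<i> * of_real t))" and "\<beta>2 \<equiv> \<lambda>t. Re (b2 (\<i> * of_real t))"
  shows "bigoh 2 (\<lambda>t. \<beta>1 t - b1_0)" "bigoh 2 (\<lambda>t. \<beta>2 t - b2_0)"
    "bigoh 4 (\<lambda>t. \<beta>1 t + \<beta>2 t - 1 / 2)" "bigoh 4 (\<lambda>t. \<beta>1 t * c1 + \<beta>2 t * c2 - 1 / 6)"
proof -
  have c: "c1 > 0" "c2 > 0" "c1 < 1" "c2 < 1" "c2 - c1 > 0"
    using c1_pos c1_less_c2 c2_less_1 by auto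
  \<comment> \<open>The linear terms of the numerator cancel because c + (1 - c) - 1 = 0; it is
    O(t^3), like the denominator.\<close>
  have bounded1: "bigoh 0 (\<lambda>t::real. (sin (c * t) + sin ((1 - c) * t) - t * cos (c * t)) / (t\<^sup>2 * sin (d * t)))"
    if "c > 0" "c < 1" "d > 0" for c d :: real
    using that by (intro bigoh_realI) real_asymp
  have \<beta>1: "bigoh 0 \<beta>1"
    by (rule bigoh_cong[OF bounded1[OF c(2,4,5)]])
      (use eventually_nondegenerate in eventually_elim, auto simp: \<beta>1_def b1_imaginary)
  have bounded2: "bigoh 0 (\<lambda>t::real. (t * cos (c * t) - sin (c * t) - sin ((1 - c) * t)) / (t\<^sup>2 * sin (d * t)))"
    if "c > 0" "c < 1" "d > 0" for c d :: real
    using that by (intro bigoh_realI) real_asymp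
  have \<beta>2: "bigoh 0 \<beta>2"
    by (rule bigoh_cong[OF bounded2[OF c(1,3,5)]])
      (use eventually_nondegenerate in eventually_elim, auto simp: \<beta>2_def b2_imaginary)

  \<comment> \<open>\<open>P\<close> and \<open>Q\<close> collect the Taylor tails of the two
    fitting equations. Since 1/24 = (1/12)/2 and 1/120 = (1/20)/6, what remains at t^2 is exactly
    the defect of the moment of degree 2 or 3.\<close>
  define P where "P = (\<lambda>t::real. ((1 - cos t) / t\<^sup>2 - 1 / 2 + t\<^sup>2 / 24)
      - (\<beta>1 t * (cos (c1 * t) - 1 + c1\<^sup>2 * t\<^sup>2 / 2) + \<beta>2 t * (cos (c2 * t) - 1 + c2\<^sup>2 * t\<^sup>2 / 2)))"
  define Q where "Q = (\<lambda>t::real. ((t - sin t) / t ^ 3 - 1 / 6 + t\<^sup>2 / 120)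
      - (\<beta>1 t * (sin (c1 * t) / t - c1 + c1 ^ 3 * t\<^sup>2 / 6) + \<beta>2 t * (sin (c2 * t) / t - c2 + c2 ^ 3 * t\<^sup>2 / 6)))"
  have P: "bigoh 4 P"
  proof -
    have *: "bigoh 4 (\<lambda>t::real. (1 - cos t) / t\<^sup>2 - 1 / 2 + t\<^sup>2 / 24)"
      by (rule bigoh_realI) real_asymp
    show ?thesis unfolding P_def
      using bigoh_mult[OF \<beta>1 cos_expansion[OF c(1)]] bigoh_mult[OF \<beta>2 cos_expansion[OF c(2)]]
      by (intro bigoh_diff[OF * bigoh_add]) simp_all
  qed
  have Q: "bigoh 4 Q"
  proof -
    have *: "bigoh 4 (\<lambda>t::real. (t - sin t) / t ^ 3 - 1 / 6 + t\<^sup>2 / 120)"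
      by (rule bigoh_realI) real_asymp
    show ?thesis unfolding Q_def
      using bigoh_mult[OF \<beta>1 sin_over_expansion[OF c(1)]] bigoh_mult[OF \<beta>2 sin_over_expansion[OF c(2)]]
      by (intro bigoh_diff[OF * bigoh_add]) simp_all
  qed
  have p: "\<forall>\<^sub>F t in at_right 0. \<beta>1 t + \<beta>2 t - 1 / 2 = P t + t\<^sup>2 * ((\<beta>1 t * c1\<^sup>2 + \<beta>2 t * c2\<^sup>2 - 1 / 12) / 2)"
    using eventually_nondegenerate
  proof eventually_elim
    case (elim t)
    then have "(1 - cos t) / t\<^sup>2 = \<beta>1 t * cos (c1 * t) + \<beta>2 t * cos (c2 * t)"
      using fitted_quadrature_imaginary(1)[of t] by (simp add: \<beta>1_def \<beta>2_def)
    then show ?case unfolding P_def by (simp add: algebra_simps add_divide_distrib diff_divide_distrib)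
  qed
  have q: "\<forall>\<^sub>F t in at_right 0. \<beta>1 t * c1 + \<beta>2 t * c2 - 1 / 6 = Q t + t\<^sup>2 * ((\<beta>1 t * c1 ^ 3 + \<beta>2 t * c2 ^ 3 - 1 / 20) / 6)"
    using eventually_nondegenerate
  proof eventually_elim
    case (elim t)
    then have "(t - sin t) / t ^ 3 = \<beta>1 t * (sin (c1 * t) / t) + \<beta>2 t * (sin (c2 * t) / t)"
      using fitted_quadrature_imaginary(2)[of t] by (simp add: \<beta>1_def \<beta>2_def)
    then show ?case unfolding Q_def by (simp add: algebra_simps add_divide_distrib diff_divide_distrib)
  qed

  have moment: "bigoh n (\<lambda>t. (\<beta>1 t * x + \<beta>2 t * y - z) / w)" if "bigoh n (\<lambda>t. \<beta>1 t * x + \<beta>2 t * y - z)" for n x y z w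
    using bigoh_mult_left[OF that, of "1 / w"] by simp
  have moment0: "bigoh 0 (\<lambda>t. \<beta>1 t * x + \<beta>2 t * y - z)" for x y z
    using bigoh_mult_left[OF \<beta>1, of x] bigoh_mult_left[OF \<beta>2, of y]
    by (intro bigoh_diff bigoh_add bigoh_const) (simp_all add: mult.commute)
  have p2: "bigoh 2 (\<lambda>t. \<beta>1 t + \<beta>2 t - 1 / 2)"
    using bigoh_mult[OF bigoh_power[of 2] moment[OF moment0]]
    by (intro bigoh_cong[OF bigoh_add[OF bigoh_le[OF P] _] p]) simp_all
  have q2: "bigoh 2 (\<lambda>t. \<beta>1 t * c1 + \<beta>2 t * c2 - 1 / 6)"
    using bigoh_mult[OF bigoh_power[of 2] moment[OF moment0]]
    by (intro bigoh_cong[OF bigoh_add[OF bigoh_le[OF Q] _] q]) simp_all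
  \<comment> \<open>Cramer's rule for the two moment equations, with determinant
    \<open>c2 - c1\<close>.\<close>
  have "bigoh 2 (\<lambda>t. 1 / (c2 - c1) * (c2 * (\<beta>1 t + \<beta>2 t - 1 / 2) - (\<beta>1 t * c1 + \<beta>2 t * c2 - 1 / 6)))"
    by (intro bigoh_mult_left bigoh_diff p2 q2)
  moreover have "1 / (c2 - c1) * (c2 * (\<beta>1 t + \<beta>2 t - 1 / 2) - (\<beta>1 t * c1 + \<beta>2 t * c2 - 1 / 6)) = \<beta>1 t - b1_0" for t
    using c(5) by (simp add: b1_0_def field_simps)
  ultimately show \<beta>1': "bigoh 2 (\<lambda>t. \<beta>1 t - b1_0)" by simp
  have "bigoh 2 (\<lambda>t. 1 / (c2 - c1) * ((\<beta>1 t * c1 + \<beta>2 t * c2 - 1 / 6) - c1 * (\<beta>1 t + \<beta>2 t - 1 / 2)))"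
    by (intro bigoh_mult_left bigoh_diff p2 q2)
  moreover have "1 / (c2 - c1) * ((\<beta>1 t * c1 + \<beta>2 t * c2 - 1 / 6) - c1 * (\<beta>1 t + \<beta>2 t - 1 / 2)) = \<beta>2 t - b2_0" for t
    using c(5) by (simp add: b2_0_def field_simps)
  ultimately show \<beta>2': "bigoh 2 (\<lambda>t. \<beta>2 t - b2_0)" by simp

  have moment2: "bigoh 2 (\<lambda>t. \<beta>1 t * x + \<beta>2 t * y - z)" if "b1_0 * x + b2_0 * y = z" for x y z
  proof -
    have "bigoh 2 (\<lambda>t. x * (\<beta>1 t - b1_0) + y * (\<beta>2 t - b2_0))"
      by (intro bigoh_add bigoh_mult_left \<beta>1' \<beta>2')
    moreover have "x * (\<beta>1 t - b1_0) + y * (\<beta>2 t - b2_0) = \<beta>1 t * x + \<beta>2 t * y - z" for t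
      using that by (simp add: algebra_simps)
    ultimately show ?thesis by simp
  qed
  show "bigoh 4 (\<lambda>t. \<beta>1 t + \<beta>2 t - 1 / 2)"
    using bigoh_mult[OF bigoh_power[of 2] moment[OF moment2[OF limit_order_conditions(3)]]]
    by (intro bigoh_cong[OF bigoh_add[OF P _] p]) simp_all
  show "bigoh 4 (\<lambda>t. \<beta>1 t * c1 + \<beta>2 t * c2 - 1 / 6)"
    using bigoh_mult[OF bigoh_power[of 2] moment[OF moment2[OF limit_order_conditions(4)]]]
    by (intro bigoh_cong[OF bigoh_add[OF Q _] q]) simp_all
qed

section \<open>Expansions in the step size at fixed frequency\<close>

lemma mu_of_imaginary: "mu_of \<omega> h = \<i> * of_real (\<omega> * h)"
  by (simp add: mu_of_def)

context
  fixes \<omega> :: real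
  assumes \<omega>: "\<omega> > 0"
begin

lemma eventually_nondegenerate_step:
  "\<forall>\<^sub>F h in at_right 0. \<omega> * h \<noteq> 0 \<and> cos (c1 * (\<omega> * h)) \<noteq> 0 \<and> cos (c2 * (\<omega> * h)) \<noteq> 0 \<and> sin ((c2 - c1) * (\<omega> * h)) \<noteq> 0"
  by (rule eventually_compose_filterlim[OF eventually_nondegenerate filterlim_scale_at_right_0[OF \<omega>]])

lemma eventually_real_coefficients:
  "\<forall>\<^sub>F h in at_right 0. real_coefficients ef_tddirk (mu_of \<omega> h)"
  using eventually_nondegenerate_step
proof eventually_elim
  case (elim h)
  then show ?case
    unfolding real_coefficients_def atLeastAtMost_1_2 mu_of_imaginary
    by (auto simp: xi1_imaginary xi2_imaginary a11_imaginary a21_def a22_imaginary b1_imaginary b2_imaginary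
        atLeastAtMost_1_2 simp del: of_real_mult)
qed

text \<open>In a stage, the product of \<xi> and its node is multiplied by h and the other
  coefficients by h^2, so orders 3 and 2 both leave O(h^4). The quadratic coefficients of the first
  two expansions are the \<kappa> of the stage errors.\<close>

lemma stage_coefficients_expansion:
  "bigoh 3 (\<lambda>h. Re (xi1 (mu_of \<omega> h)) * c1 - (c1 + c1 ^ 3 / 3 * (\<omega> * h)\<^sup>2))"
  "bigoh 3 (\<lambda>h. Re (xi2 (mu_of \<omega> h)) * c2 - (c2 + (c2 ^ 3 / 3 - phi * (c2 - c1)) * (\<omega> * h)\<^sup>2))"
  "bigoh 2 (\<lambda>h. Re (a11 (mu_of \<omega> h)) - c1\<^sup>2 / 2)"
  "bigoh 2 (\<lambda>h. Re (a22 (mu_of \<omega> h)) - (c2\<^sup>2 / 2 - phi))"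
proof -
  have c: "c1 > 0" "c2 > 0" "c2 - c1 > 0"
    using c1_pos c1_less_c2 by auto
  show "bigoh 3 (\<lambda>h. Re (xi1 (mu_of \<omega> h)) * c1 - (c1 + c1 ^ 3 / 3 * (\<omega> * h)\<^sup>2))"
    by (rule bigoh_cong[OF bigoh_rescale[OF tan_over_expansion[OF c(1)] \<omega>]])
      (use eventually_nondegenerate_step in eventually_elim,
        use c in \<open>auto simp: mu_of_imaginary xi1_imaginary simp del: of_real_mult\<close>)
  show "bigoh 2 (\<lambda>h. Re (a11 (mu_of \<omega> h)) - c1\<^sup>2 / 2)"
    by (rule bigoh_cong[OF bigoh_rescale[OF sec_over_square_expansion[OF c(1)] \<omega>]])
      (use eventually_nondegenerate_step in eventually_elim,
        auto simp: mu_of_imaginary a11_imaginary simp del: of_real_mult)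
  have "bigoh 2 (\<lambda>t::real. ((1 - cos (c2 * t)) / (t\<^sup>2 * cos (c2 * t)) - c2\<^sup>2 / 2)
      - phi * (cos (c1 * t) / cos (c2 * t) - 1))"
    by (intro bigoh_diff bigoh_mult_left sec_over_square_expansion cos_quotient_expansion c)
  note * = bigoh_rescale[OF this \<omega>]
  show "bigoh 2 (\<lambda>h. Re (a22 (mu_of \<omega> h)) - (c2\<^sup>2 / 2 - phi))"
    by (rule bigoh_cong[OF *])
      (use eventually_nondegenerate_step in eventually_elim,
        auto simp: mu_of_imaginary a22_imaginary right_diff_distrib simp del: of_real_mult)
  have "bigoh 4 (\<lambda>t::real. t\<^sup>2 * (sin ((c2 - c1) * t) / (t * cos (c2 * t)) - (c2 - c1)))"
    using bigoh_mult[OF bigoh_power[of 2] sin_quotient_expansion[OF c(2,3)]] by simp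
  from bigoh_le[OF bigoh_mult_left[OF this, of phi], of 3]
  have "bigoh 3 (\<lambda>t::real. (sin (c2 * t) / (t * cos (c2 * t)) - (c2 + c2 ^ 3 / 3 * t\<^sup>2))
      - phi * (t\<^sup>2 * (sin ((c2 - c1) * t) / (t * cos (c2 * t)) - (c2 - c1))))"
    by (intro bigoh_diff tan_over_expansion c) simp
  note * = bigoh_rescale[OF this \<omega>]
  show "bigoh 3 (\<lambda>h. Re (xi2 (mu_of \<omega> h)) * c2 - (c2 + (c2 ^ 3 / 3 - phi * (c2 - c1)) * (\<omega> * h)\<^sup>2))"
  proof (rule bigoh_cong[OF *], use eventually_nondegenerate_step in eventually_elim)
    case (elim h)
    define t where "t = \<omega> * h"
    have "Re (xi2 (\<i> * of_real t)) * c2 = sin (c2 * t) / (t * cos (c2 * t))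
        - phi * t\<^sup>2 * (sin ((c2 - c1) * t) / (t * cos (c2 * t)))"
      using elim c(2) unfolding t_def[symmetric] by (subst xi2_imaginary) auto
    then show ?case
      unfolding mu_of_imaginary t_def[symmetric] by (simp add: algebra_simps)
  qed
qed

lemmas weights_expansion = quadrature_weights_expansion[THEN bigoh_rescale[OF _ \<omega>], folded mu_of_imaginary]

end

section \<open>Solvability of the stage equations\<close>

text \<open>Existence and uniqueness use different balls: Banach's theorem runs on the closed ball
  of radius r/2, which keeps the fixed point inside the open ball, while the contraction estimate on
  the full ball excludes any other solution there.\<close>

lemma implicit_stage_unique_solution:
  fixes G :: "'a::euclidean_space \<Rightarrow> 'a"
  assumes lip: "\<And>x y. x \<in> cball p r \<Longrightarrow> y \<in> cball p r \<Longrightarrow> norm (G x - G y) \<le> L * norm (x - y)"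
    and "L > 0" "r > 0" and small: "norm (A - p) + \<bar>\<alpha>\<bar> * (norm (G p) + L * r) \<le> r / 2" and contr: "\<bar>\<alpha>\<bar> * L < 1"
  shows "\<exists>!X. X \<in> ball p r \<and> X = A + \<alpha> *\<^sub>R G X"
proof -
  have dist_le: "dist (A + \<alpha> *\<^sub>R G x) (A + \<alpha> *\<^sub>R G y) \<le> (\<bar>\<alpha>\<bar> * L) * dist x y"
    if "x \<in> cball p r" "y \<in> cball p r" for x y
    using mult_left_mono[OF lip[OF that], of "\<bar>\<alpha>\<bar>"]
    by (simp add: dist_norm scaleR_diff_right[symmetric] mult.assoc)
  have "\<exists>!X\<in>cball p (r / 2). A + \<alpha> *\<^sub>R G X = X"
  proof (rule Banach_fix[of _ "\<bar>\<alpha>\<bar> * L"])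
    show "complete (cball p (r / 2))" by (simp add: complete_eq_closed)
    show "cball p (r / 2) \<noteq> {}" "0 \<le> \<bar>\<alpha>\<bar> * L" "\<bar>\<alpha>\<bar> * L < 1"
      using \<open>L > 0\<close> \<open>r > 0\<close> contr by auto
    show "dist (A + \<alpha> *\<^sub>R G x) (A + \<alpha> *\<^sub>R G y) \<le> (\<bar>\<alpha>\<bar> * L) * dist x y"
      if "x \<in> cball p (r / 2)" "y \<in> cball p (r / 2)" for x y
      using that \<open>r > 0\<close> by (intro dist_le) auto
    show "(\<lambda>X. A + \<alpha> *\<^sub>R G X) ` cball p (r / 2) \<subseteq> cball p (r / 2)"
    proof (intro image_subsetI)
      fix x assume "x \<in> cball p (r / 2)"
      then have x: "x \<in> cball p r" using \<open>r > 0\<close> by auto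
      have "norm (G x) \<le> norm (G p) + norm (G x - G p)" using norm_triangle_sub by blast
      also have "\<dots> \<le> norm (G p) + L * norm (x - p)" using lip[of x p] x \<open>r > 0\<close> by simp
      also have "\<dots> \<le> norm (G p) + L * r"
        using x \<open>L > 0\<close> by (simp add: dist_norm norm_minus_commute)
      finally have "\<bar>\<alpha>\<bar> * norm (G x) \<le> \<bar>\<alpha>\<bar> * (norm (G p) + L * r)" by (rule mult_left_mono) simp
      moreover have "norm ((A - p) + \<alpha> *\<^sub>R G x) \<le> norm (A - p) + \<bar>\<alpha>\<bar> * norm (G x)"
        using norm_triangle_ineq[of "A - p" "\<alpha> *\<^sub>R G x"] by simp
      ultimately have "norm ((A - p) + \<alpha> *\<^sub>R G x) \<le> r / 2" using small by linarith
      then show "A + \<alpha> *\<^sub>R G x \<in> cball p (r / 2)"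
        by (simp add: dist_norm norm_minus_commute algebra_simps)
    qed
  qed
  then obtain X where X: "X \<in> cball p (r / 2)" "A + \<alpha> *\<^sub>R G X = X" by blast
  show ?thesis
  proof (rule ex1I[of _ X])
    show "X \<in> ball p r \<and> X = A + \<alpha> *\<^sub>R G X" using X \<open>r > 0\<close> by simp
  next
    fix Z assume Z: "Z \<in> ball p r \<and> Z = A + \<alpha> *\<^sub>R G Z"
    then have "dist Z X \<le> (\<bar>\<alpha>\<bar> * L) * dist Z X"
      using dist_le[of Z X] X \<open>r > 0\<close> by (auto simp: less_imp_le)
    then have "(1 - \<bar>\<alpha>\<bar> * L) * dist Z X \<le> 0" by (simp add: algebra_simps)
    then show "Z = X" using contr by (simp add: mult_le_0_iff)
  qed
qed

text \<open>The radius stays fixed; both smallness conditions are met by shrinking the step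
  alone.\<close>

lemma eventually_implicit_stage:
  fixes G :: "'a::euclidean_space \<Rightarrow> 'a"
  assumes lip: "\<And>x y. x \<in> cball p r \<Longrightarrow> y \<in> cball p r \<Longrightarrow> norm (G x - G y) \<le> L * norm (x - y)"
    and "L > 0" "r > 0" and A: "(A \<longlongrightarrow> p) (at_right (0::real))" and \<alpha>: "(\<alpha> \<longlongrightarrow> 0) (at_right 0)"
  shows "\<forall>\<^sub>F h in at_right 0. \<exists>!X. X \<in> ball p r \<and> X = A h + \<alpha> h *\<^sub>R G X"
proof -
  have "((\<lambda>h. norm (A h - p) + \<bar>\<alpha> h\<bar> * (norm (G p) + L * r)) \<longlongrightarrow> norm (p - p) + \<bar>0\<bar> * (norm (G p) + L * r)) (at_right 0)"
    by (intro tendsto_intros A \<alpha>)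
  then have "\<forall>\<^sub>F h in at_right 0. norm (A h - p) + \<bar>\<alpha> h\<bar> * (norm (G p) + L * r) < r / 2"
    using \<open>r > 0\<close> by (intro order_tendstoD) auto
  moreover have "((\<lambda>h. \<bar>\<alpha> h\<bar> * L) \<longlongrightarrow> \<bar>0\<bar> * L) (at_right 0)"
    by (intro tendsto_intros \<alpha>)
  then have "\<forall>\<^sub>F h in at_right 0. \<bar>\<alpha> h\<bar> * L < 1"
    by (intro order_tendstoD) auto
  ultimately show ?thesis
  proof eventually_elim
    case (elim h)
    then show ?case using implicit_stage_unique_solution[OF lip \<open>L > 0\<close> \<open>r > 0\<close>] by simp
  qed
qed

section \<open>The local error\<close>

lemma bigoh_dominated:
  assumes "bigoh n v" "\<forall>\<^sub>F h in at_right 0. norm (u h) \<le> norm (v h)"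
  shows "bigoh n u"
proof -
  obtain C where "\<forall>\<^sub>F h in at_right 0. norm (v h) \<le> C * h ^ n" using assms(1) by (rule bigohE)
  with assms(2) have "\<forall>\<^sub>F h in at_right 0. norm (u h) \<le> C * h ^ n" by eventually_elim simp
  then show ?thesis by (auto simp: bigoh_def)
qed

lemma bigoh_norm: "bigoh n u \<Longrightarrow> bigoh n (\<lambda>h. norm (u h))"
  by (simp add: bigoh_def)

text \<open>Time is shifted so that the step starts at 0. The derivative is taken within [0,T],
  hence one-sided at the starting point.\<close>

locale smooth_solution =
  fixes f :: "'a::euclidean_space \<Rightarrow> 'a" and U :: "'a set" and u :: "real \<Rightarrow> 'a" and T r :: real
  assumes open_U: "open U" and smooth: "Ck_on 5 U f" and T_pos: "T > 0"
    and solution_in: "\<And>t. t \<in> {0..T} \<Longrightarrow> u t \<in> U"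
    and solution: "\<And>t. t \<in> {0..T} \<Longrightarrow> (u has_vector_derivative f (u t)) (at t within {0..T})"
    and r_pos: "r > 0" and cball_subset: "cball (u 0) r \<subseteq> U"
begin

text \<open>The time derivatives of \<open>u\<close>, written as functions of the state. The index
  is shifted by one because u' is already \<open>f\<close> on the solution.\<close>

definition D :: "nat \<Rightarrow> real \<Rightarrow> 'a" where
  "D k t = (case k of 0 \<Rightarrow> u t | Suc j \<Rightarrow> (lie_derivative f ^^ j) f (u t))"

abbreviation g :: "'a \<Rightarrow> 'a" where "g \<equiv> second_derivative_field f"

lemma g_eq: "g = lie_derivative f f"
  by (simp add: fun_eq_iff second_derivative_field_def lie_derivative_def)

lemma g_solution: "g (u t) = D 2 t"
  by (simp add: D_def g_eq numeral_2_eq_2)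

lemma Ck_on_iterate: "k \<le> 5 \<Longrightarrow> Ck_on (5 - k) U ((lie_derivative f ^^ k) f)"
  by (rule Ck_on_lie_derivative_iterate[OF open_U smooth])

lemma D_deriv:
  assumes "m < 6" "t \<in> {0..T}"
  shows "(D m has_vector_derivative D (Suc m) t) (at t within {0..T})"
proof (cases m)
  case 0
  then show ?thesis using solution[OF assms(2)] by (simp add: D_def[abs_def])
next
  case (Suc j)
  \<comment> \<open>From m < 6 follows j \<le> 4, so the iterate is still at least C^1; the case j =
    4 uses all the smoothness of \<open>f\<close>.\<close>
  then have "Ck_on (Suc (4 - j)) U ((lie_derivative f ^^ j) f)"
    using Ck_on_iterate[of j] assms(1) by (simp add: Suc_diff_le flip: Suc_diff_le del: Ck_on.simps)
  from has_vector_derivative_along_solution[where f = f, OF this solution_in solution] assms(2) Suc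
  show ?thesis by (simp add: D_def[abs_def])
qed

lemma D_bounded:
  assumes "m \<le> 6"
  obtains C where "\<And>t. t \<in> {0..T} \<Longrightarrow> norm (D m t) \<le> C"
proof -
  have u: "continuous_on {0..T} u"
    using solution has_vector_derivative_continuous continuous_on_eq_continuous_within by blast
  have "continuous_on {0..T} (D m)"
  proof (cases m)
    case 0
    then show ?thesis using u by (simp add: D_def[abs_def])
  next
    case (Suc j)
    then have "Ck_on 0 U ((lie_derivative f ^^ j) f)"
      using Ck_on_le[OF Ck_on_iterate[of j], of 0] assms by (simp del: Ck_on.simps)
    then have "continuous_on U ((lie_derivative f ^^ j) f)" by simp
    then have "continuous_on {0..T} (\<lambda>t. (lie_derivative f ^^ j) f (u t))"
      by (rule continuous_on_compose2[OF _ u]) (use solution_in in auto)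
    then show ?thesis using Suc by (simp add: D_def[abs_def])
  qed
  then have "bounded (D m ` {0..T})"
    by (intro compact_imp_bounded compact_continuous_image) auto
  then show ?thesis using that unfolding bounded_iff by (metis imageI)
qed

lemma eventually_in_interval: "c > 0 \<Longrightarrow> \<forall>\<^sub>F h in at_right 0. c * h \<in> {0..T}"
  by (rule eventually_at_rightI[of 0 "T / c"]) (use T_pos in \<open>auto simp: field_simps\<close>)

lemma solution_expansion:
  assumes "m + n \<le> 6" "c > 0"
  shows "bigoh n (\<lambda>h. D m (c * h) - (\<Sum>k<n. ((c * h) ^ k / fact k) *\<^sub>R D (m + k) 0))"
proof -
  obtain C where C: "\<And>t. t \<in> {0..T} \<Longrightarrow> norm (D (m + n) t) \<le> C"
    using D_bounded[OF assms(1)] by blast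
  have *: "norm (D m t - (\<Sum>k<n. (t ^ k / fact k) *\<^sub>R D (m + k) 0)) \<le> C * t ^ n" if "t \<in> {0..T}" for t
    using taylor_vector_bound[of n T "\<lambda>k. D (m + k)" C t] D_deriv C that assms(1) by simp
  have "\<forall>\<^sub>F h in at_right 0. norm (D m (c * h) - (\<Sum>k<n. ((c * h) ^ k / fact k) *\<^sub>R D (m + k) 0)) \<le> (C * c ^ n) * h ^ n"
    using eventually_in_interval[OF assms(2)]
  proof eventually_elim
    case (elim h)
    from this[THEN *] show ?case by (simp only: power_mult_distrib mult.assoc)
  qed
  then show ?thesis by (auto simp: bigoh_def)
qed

lemma solution_near_start: "c > 0 \<Longrightarrow> bigoh 1 (\<lambda>h. u (c * h) - u 0)"
  using solution_expansion[of 0 1 c] by (simp add: D_def)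

lemma eventually_solution_in_ball:
  assumes "c > 0" "\<epsilon> > 0"
  shows "\<forall>\<^sub>F h in at_right 0. norm (u (c * h) - u 0) < \<epsilon>"
proof -
  have "((\<lambda>h. norm (u (c * h) - u 0)) \<longlongrightarrow> 0) (at_right 0)"
    using bigoh_imp_tendsto_0[OF bigoh_norm[OF solution_near_start[OF assms(1)]]] by simp
  then show ?thesis using assms(2) by (rule order_tendstoD)
qed

section \<open>Transfer of stage errors through the second derivative field\<close>

lemma Ck_on_g: "Ck_on 4 U g"
  using Ck_on_iterate[of 1] by (simp add: g_eq del: Ck_on.simps)

lemma g_lipschitz:
  obtains L where "L > 0"
    "\<And>x y. x \<in> cball (u 0) r \<Longrightarrow> y \<in> cball (u 0) r \<Longrightarrow> norm (g x - g y) \<le> L * norm (x - y)"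
  using C1_lipschitz_on_cball[OF Ck_on_le[OF Ck_on_g] cball_subset] by auto

lemma bigoh_g_diff:
  assumes "bigoh n (\<lambda>h. Y h - u (c * h))" "c > 0" "\<forall>\<^sub>F h in at_right 0. Y h \<in> ball (u 0) r"
  shows "bigoh n (\<lambda>h. g (Y h) - D 2 (c * h))"
proof -
  obtain L where L: "L > 0"
    "\<And>x y. x \<in> cball (u 0) r \<Longrightarrow> y \<in> cball (u 0) r \<Longrightarrow> norm (g x - g y) \<le> L * norm (x - y)"
    using g_lipschitz by blast
  have "\<forall>\<^sub>F h in at_right 0. norm (g (Y h) - D 2 (c * h)) \<le> norm (L *\<^sub>R (Y h - u (c * h)))"
    using assms(3) eventually_solution_in_ball[OF assms(2) r_pos]
  proof eventually_elim
    case (elim h)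
    then show ?case using L(2)[of "Y h" "u (c * h)"] L(1)
      by (simp add: g_solution dist_norm norm_minus_commute)
  qed
  then show ?thesis
    by (rule bigoh_dominated[OF bigoh_bounded_linear[OF bounded_linear_scaleR_right assms(1)]])
qed

lemma bigoh_g_bounded:
  assumes "\<forall>\<^sub>F h in at_right 0. Y h \<in> ball (u 0) r"
  shows "bigoh 0 (\<lambda>h. g (Y h))"
proof -
  obtain L where L: "L > 0"
    "\<And>x y. x \<in> cball (u 0) r \<Longrightarrow> y \<in> cball (u 0) r \<Longrightarrow> norm (g x - g y) \<le> L * norm (x - y)"
    using g_lipschitz by blast
  have "\<forall>\<^sub>F h in at_right 0. norm (g (Y h)) \<le> norm (g (u 0)) + L * r"
    using assms
  proof eventually_elim
    case (elim h)
    then have "norm (g (Y h) - g (u 0)) \<le> L * norm (Y h - u 0)" using L(2)[of "Y h" "u 0"] r_pos by simp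
    also have "\<dots> \<le> L * r" using elim L(1) by (simp add: dist_norm norm_minus_commute)
    finally show ?case using norm_triangle_sub[of "g (Y h)" "g (u 0)"] by linarith
  qed
  then show ?thesis by (auto simp: bigoh_def)
qed

text \<open>The derivative can be frozen at the starting point: both arguments lie within O(h) of
  it, so the linearization error is O(h) times the O(h^3) stage error.\<close>

lemma bigoh_g_linearization:
  assumes Y: "bigoh 3 (\<lambda>h. Y h - u (c * h))" and "c > 0"
  shows "bigoh 4 (\<lambda>h. g (Y h) - D 2 (c * h) - frechet_derivative g (at (u 0)) (Y h - u (c * h)))"
proof -
  obtain K where K: "K > 0"
    "\<And>x y \<rho>. x \<in> cball (u 0) \<rho> \<Longrightarrow> y \<in> cball (u 0) \<rho> \<Longrightarrow> \<rho> \<le> r \<Longrightarrow>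
       norm (g x - g y - frechet_derivative g (at (u 0)) (x - y)) \<le> K * \<rho> * norm (x - y)"
    using C2_linearization_on_cball[OF Ck_on_le[OF Ck_on_g, of 2] cball_subset] by auto
  define \<rho> where "\<rho> = (\<lambda>h. norm (Y h - u (c * h)) + norm (u (c * h) - u 0))"
  have \<rho>: "bigoh 1 \<rho>"
    unfolding \<rho>_def by (intro bigoh_add bigoh_norm solution_near_start assms bigoh_le[OF Y]) simp
  then have "(\<rho> \<longlongrightarrow> 0) (at_right 0)" by (rule bigoh_imp_tendsto_0) simp
  then have "\<forall>\<^sub>F h in at_right 0. \<rho> h < r" using r_pos by (rule order_tendstoD)
  then have "\<forall>\<^sub>F h in at_right 0. norm (g (Y h) - D 2 (c * h) - frechet_derivative g (at (u 0)) (Y h - u (c * h)))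
      \<le> norm ((K * \<rho> h) *\<^sub>R (Y h - u (c * h)))"
  proof eventually_elim
    case (elim h)
    have "norm (Y h - u 0) \<le> \<rho> h"
      unfolding \<rho>_def using norm_triangle_ineq[of "Y h - u (c * h)" "u (c * h) - u 0"] by simp
    moreover have "norm (u (c * h) - u 0) \<le> \<rho> h" "\<rho> h \<ge> 0" by (auto simp: \<rho>_def)
    ultimately show ?case
      using K(2)[of "Y h" "\<rho> h" "u (c * h)"] K(1) elim
      by (simp add: g_solution dist_norm norm_minus_commute)
  qed
  moreover have "bigoh 4 (\<lambda>h. (K * \<rho> h) *\<^sub>R (Y h - u (c * h)))"
    using bigoh_scaleR[OF bigoh_mult_left[OF \<rho>] Y] by simp
  ultimately show ?thesis by (rule bigoh_dominated[rotated])
qed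

text \<open>The defect of a stage starts with the vector \<open>y''' + \<omega>\<^sup>2 y'\<close>, which is zero for \<open>y = exp (\<plusminus>\<i>\<omega>x)\<close>.\<close>

lemma stage_error:
  fixes x a :: "real \<Rightarrow> real" and \<omega> c c' p :: real
  defines "\<kappa> \<equiv> c ^ 3 / 3 - p * (c - c')"
  assumes c: "c > 0" "c' > 0"
    and stage: "\<forall>\<^sub>F h in at_right 0. Y h \<in> ball (u 0) r \<and>
      Y h = u 0 + (x h * h) *\<^sub>R f (u 0) + h\<^sup>2 *\<^sub>R (p *\<^sub>R g (Z h) + a h *\<^sub>R g (Y h))"
    and Z: "bigoh 2 (\<lambda>h. Z h - u (c' * h))" "\<forall>\<^sub>F h in at_right 0. Z h \<in> ball (u 0) r"
    and x: "bigoh 3 (\<lambda>h. x h - (c + \<kappa> * (\<omega> * h)\<^sup>2))" and a: "bigoh 2 (\<lambda>h. a h - (c\<^sup>2 / 2 - p))"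
  shows "bigoh 4 (\<lambda>h. Y h - u (c * h) - (\<kappa> * h ^ 3) *\<^sub>R (D 3 0 + \<omega>\<^sup>2 *\<^sub>R D 1 0))"
proof -
  have stage_ball: "\<forall>\<^sub>F h in at_right 0. Y h \<in> ball (u 0) r" using stage by eventually_elim simp
  have D1: "f (u 0) = D 1 0" and D0: "\<And>t. u t = D 0 t" by (simp_all add: D_def)
  have a0: "bigoh 0 a"
    using bigoh_add[OF bigoh_le[OF a, of 0] bigoh_const[of "c\<^sup>2 / 2 - p"]] by simp
  have sq: "bigoh 2 (\<lambda>h::real. h\<^sup>2)" by (rule bigoh_power)
  \<comment> \<open>First pass: with the slopes merely bounded, the stage error is O(h^2).\<close>
  have x2: "bigoh 2 (\<lambda>h. (x h - c) * h)"
  proof -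
    have "bigoh 2 (\<lambda>h::real. (\<kappa> * \<omega>\<^sup>2) * h\<^sup>2)" by (intro bigoh_mult_left bigoh_power)
    from bigoh_add[OF bigoh_le[OF x, of 2] this] have "bigoh 2 (\<lambda>h. x h - c)"
      by (simp add: power_mult_distrib mult.assoc)
    from bigoh_le[OF bigoh_mult[OF this bigoh_power[of 1]], of 2] show ?thesis by simp
  qed
  have u2: "bigoh 2 (\<lambda>h. u (c * h) - u 0 - (c * h) *\<^sub>R D 1 0)"
    using solution_expansion[of 0 2 c] c by (simp add: D0 numeral_2_eq_2 algebra_simps)
  have "bigoh 2 (\<lambda>h. ((x h - c) * h) *\<^sub>R D 1 0 + h\<^sup>2 *\<^sub>R (p *\<^sub>R g (Z h) + a h *\<^sub>R g (Y h))
      - (u (c * h) - u 0 - (c * h) *\<^sub>R D 1 0))"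
  proof (rule bigoh_diff[OF bigoh_add[OF bigoh_scaleR_left[OF x2]] u2])
    have "bigoh 0 (\<lambda>h. p *\<^sub>R g (Z h) + a h *\<^sub>R g (Y h))"
      using bigoh_scaleR[OF a0 bigoh_g_bounded[OF stage_ball]]
      by (intro bigoh_add bigoh_bounded_linear[OF bounded_linear_scaleR_right] bigoh_g_bounded Z) simp
    from bigoh_scaleR[OF sq this]
    show "bigoh 2 (\<lambda>h. h\<^sup>2 *\<^sub>R (p *\<^sub>R g (Z h) + a h *\<^sub>R g (Y h)))" by simp
  qed
  then have Y2: "bigoh 2 (\<lambda>h. Y h - u (c * h))"
  proof (rule bigoh_cong, use stage in eventually_elim)
    case (elim h)
    then have "Y h = u 0 + (x h * h) *\<^sub>R D 1 0 + h\<^sup>2 *\<^sub>R (p *\<^sub>R g (Z h) + a h *\<^sub>R g (Y h))"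
      by (simp only: D1)
    then show ?case by (simp add: algebra_simps)
  qed

  have z: "bigoh 2 (\<lambda>h. D 2 (d * h) - (D 2 0 + (d * h) *\<^sub>R D 3 0))" if "d > 0" for d
    using solution_expansion[of 2 2 d] that by (simp add: numeral_2_eq_2 numeral_3_eq_3)
  \<comment> \<open>Second pass: fed through the Lipschitz bound, the crude error gives the slopes
    up to O(h^2), hence the stage up to O(h^4).\<close>
  have gY: "bigoh 2 (\<lambda>h. g (Y h) - (D 2 0 + (c * h) *\<^sub>R D 3 0))"
    using bigoh_add[OF bigoh_g_diff[OF Y2 c(1) stage_ball] z[OF c(1)]] by (simp add: algebra_simps)
  have gZ: "bigoh 2 (\<lambda>h. g (Z h) - (D 2 0 + (c' * h) *\<^sub>R D 3 0))"
    using bigoh_add[OF bigoh_g_diff[OF Z(1) c(2) Z(2)] z[OF c(2)]] by (simp add: algebra_simps)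
  have lin: "bigoh 0 (\<lambda>h. D 2 0 + (c * h) *\<^sub>R D 3 0)"
    by (intro bigoh_add bigoh_const bigoh_scaleR_left bigoh_mult_left bigoh_le[OF bigoh_power[of 1, simplified]]) simp
  have bracket: "bigoh 2 (\<lambda>h. p *\<^sub>R (g (Z h) - (D 2 0 + (c' * h) *\<^sub>R D 3 0))
      + a h *\<^sub>R (g (Y h) - (D 2 0 + (c * h) *\<^sub>R D 3 0))
      + (a h - (c\<^sup>2 / 2 - p)) *\<^sub>R (D 2 0 + (c * h) *\<^sub>R D 3 0))"
    using bigoh_scaleR[OF a0 gY] bigoh_scaleR[OF a lin]
    by (intro bigoh_add bigoh_bounded_linear[OF bounded_linear_scaleR_right] gZ) (simp_all del: add_2_eq_Suc')
  have u4: "bigoh 4 (\<lambda>h. u (c * h) - (u 0 + (c * h) *\<^sub>R D 1 0 + ((c * h)\<^sup>2 / 2) *\<^sub>R D 2 0 + ((c * h) ^ 3 / 6) *\<^sub>R D 3 0))"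
    using solution_expansion[of 0 4 c] c by (simp add: D0 eval_nat_numeral fact_numeral mult_ac)
  \<comment> \<open>The h^3 terms: y''' has coefficient p c' + (c^2/2 - p) c - c^3/6 = \<kappa>, and
    y' has \<kappa> \<omega>^2 from the expansion of \<open>x\<close>.\<close>
  have "bigoh 4 (\<lambda>h. ((x h - (c + \<kappa> * (\<omega> * h)\<^sup>2)) * h) *\<^sub>R D 1 0
      + h\<^sup>2 *\<^sub>R (p *\<^sub>R (g (Z h) - (D 2 0 + (c' * h) *\<^sub>R D 3 0))
        + a h *\<^sub>R (g (Y h) - (D 2 0 + (c * h) *\<^sub>R D 3 0))
        + (a h - (c\<^sup>2 / 2 - p)) *\<^sub>R (D 2 0 + (c * h) *\<^sub>R D 3 0))
      - (u (c * h) - (u 0 + (c * h) *\<^sub>R D 1 0 + ((c * h)\<^sup>2 / 2) *\<^sub>R D 2 0 + ((c * h) ^ 3 / 6) *\<^sub>R D 3 0)))"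
    using bigoh_mult[OF x bigoh_power[of 1]] bigoh_scaleR[OF sq bracket]
    by (intro bigoh_diff[OF bigoh_add u4] bigoh_scaleR_left) simp_all
  then show ?thesis
  proof (rule bigoh_cong, use stage in eventually_elim)
    case (elim h)
    then have Y: "Y h = u 0 + (x h * h) *\<^sub>R D 1 0 + h\<^sup>2 *\<^sub>R (p *\<^sub>R g (Z h) + a h *\<^sub>R g (Y h))"
      by (simp only: D1)
    show ?case
    proof (rule euclidean_eqI)
      fix b :: 'a assume "b \<in> Basis"
      \<comment> \<open>The equation is implicit in \<open>Y h\<close>; naming the slope components
        turns it into an explicit scalar formula.\<close>
      define Yb Zb where "Yb = g (Y h) \<bullet> b" and "Zb = g (Z h) \<bullet> b"
      have "Y h \<bullet> b = (u 0 + (x h * h) *\<^sub>R D 1 0 + h\<^sup>2 *\<^sub>R (p *\<^sub>R g (Z h) + a h *\<^sub>R g (Y h))) \<bullet> b"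
        using Y by (rule arg_cong)
      then have Yhb: "Y h \<bullet> b = u 0 \<bullet> b + (x h * h) * (D 1 0 \<bullet> b) + h\<^sup>2 * (p * Zb + a h * Yb)"
        by (simp add: inner_simps Yb_def Zb_def)
      show "(Y h - u (c * h) - (\<kappa> * h ^ 3) *\<^sub>R (D 3 0 + \<omega>\<^sup>2 *\<^sub>R D 1 0)) \<bullet> b =
        (((x h - (c + \<kappa> * (\<omega> * h)\<^sup>2)) * h) *\<^sub>R D 1 0
      + h\<^sup>2 *\<^sub>R (p *\<^sub>R (g (Z h) - (D 2 0 + (c' * h) *\<^sub>R D 3 0))
        + a h *\<^sub>R (g (Y h) - (D 2 0 + (c * h) *\<^sub>R D 3 0))
        + (a h - (c\<^sup>2 / 2 - p)) *\<^sub>R (D 2 0 + (c * h) *\<^sub>R D 3 0))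
      - (u (c * h) - (u 0 + (c * h) *\<^sub>R D 1 0 + ((c * h)\<^sup>2 / 2) *\<^sub>R D 2 0 + ((c * h) ^ 3 / 6) *\<^sub>R D 3 0))) \<bullet> b"
        unfolding inner_diff_left inner_add_left inner_scaleR_left Yhb Yb_def[symmetric] Zb_def[symmetric] \<kappa>_def
        by (simp add: field_simps power2_eq_square power3_eq_cube)
    qed
  qed
qed

text \<open>The Taylor expansion of the second derivative along the solution, plus the stage error
  pushed through the linearization; the error first shows at h^3.\<close>

lemma bigoh_stage_slope:
  assumes Y: "bigoh 4 (\<lambda>h. Y h - u (c * h) - (\<kappa> * h ^ 3) *\<^sub>R v)" and "c > 0"
  shows "bigoh 4 (\<lambda>h. g (Y h) - (D 2 0 + (c * h) *\<^sub>R D 3 0 + ((c * h)\<^sup>2 / 2) *\<^sub>R D 4 0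
    + ((c * h) ^ 3 / 6) *\<^sub>R D 5 0 + (\<kappa> * h ^ 3) *\<^sub>R frechet_derivative g (at (u 0)) v))"
proof -
  let ?G = "frechet_derivative g (at (u 0))"
  have G: "bounded_linear ?G"
    using has_derivative_frechet[of 3 U g "u 0"] Ck_on_g solution_in[of 0] T_pos
    by (simp add: has_derivative_bounded_linear eval_nat_numeral)
  interpret G: bounded_linear ?G by (rule G)
  have "bigoh 3 (\<lambda>h. (\<kappa> * h ^ 3) *\<^sub>R v)"
    by (intro bigoh_scaleR_left bigoh_mult_left bigoh_power)
  from bigoh_add[OF bigoh_le[OF Y, of 3] this] have Y3: "bigoh 3 (\<lambda>h. Y h - u (c * h))" by simp
  have z: "bigoh 4 (\<lambda>h. D 2 (c * h) - (D 2 0 + (c * h) *\<^sub>R D 3 0 + ((c * h)\<^sup>2 / 2) *\<^sub>R D 4 0 + ((c * h) ^ 3 / 6) *\<^sub>R D 5 0))"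
    using solution_expansion[of 2 4 c] assms(2) by (simp add: eval_nat_numeral fact_numeral mult_ac)
  have lin: "?G (Y h - u (c * h) - (\<kappa> * h ^ 3) *\<^sub>R v) = ?G (Y h - u (c * h)) - (\<kappa> * h ^ 3) *\<^sub>R ?G v" for h
    by (simp only: G.diff G.scaleR)
  from bigoh_add[OF bigoh_add[OF bigoh_g_linearization[OF Y3 assms(2)] bigoh_bounded_linear[OF G Y, unfolded lin]] z]
  show ?thesis by (simp add: algebra_simps)
qed

text \<open>Sorted by powers of h, the step differs from the Taylor expansion by moment defects.
  High moments carry a power of h and need only the limit weights to be exact; the lowest must be
  accurate to O(h^4). The last condition removes the stage errors.\<close>

lemma step_error:
  fixes w1 w2 :: "real \<Rightarrow> real" and \<beta>1 \<beta>2 \<kappa>1 \<kappa>2 d1 d2 :: real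
  assumes d: "d1 > 0" "d2 > 0"
    and Y1: "bigoh 4 (\<lambda>h. Y1 h - u (d1 * h) - (\<kappa>1 * h ^ 3) *\<^sub>R v)"
    and Y2: "bigoh 4 (\<lambda>h. Y2 h - u (d2 * h) - (\<kappa>2 * h ^ 3) *\<^sub>R v)"
    and w1: "bigoh 2 (\<lambda>h. w1 h - \<beta>1)" and w2: "bigoh 2 (\<lambda>h. w2 h - \<beta>2)"
    and m0: "bigoh 4 (\<lambda>h. w1 h + w2 h - 1 / 2)" and m1: "bigoh 4 (\<lambda>h. w1 h * d1 + w2 h * d2 - 1 / 6)"
    and \<beta>: "\<beta>1 * d1\<^sup>2 + \<beta>2 * d2\<^sup>2 = 1 / 12" "\<beta>1 * d1 ^ 3 + \<beta>2 * d2 ^ 3 = 1 / 20" "\<beta>1 * \<kappa>1 + \<beta>2 * \<kappa>2 = 0"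
  shows "bigoh 6 (\<lambda>h. u h - (u 0 + h *\<^sub>R f (u 0) + h\<^sup>2 *\<^sub>R (w1 h *\<^sub>R g (Y1 h) + w2 h *\<^sub>R g (Y2 h))))"
proof -
  let ?Gv = "frechet_derivative g (at (u 0)) v"
  define R1 where "R1 = (\<lambda>h. g (Y1 h) - (D 2 0 + (d1 * h) *\<^sub>R D 3 0 + ((d1 * h)\<^sup>2 / 2) *\<^sub>R D 4 0
    + ((d1 * h) ^ 3 / 6) *\<^sub>R D 5 0 + (\<kappa>1 * h ^ 3) *\<^sub>R ?Gv))"
  define R2 where "R2 = (\<lambda>h. g (Y2 h) - (D 2 0 + (d2 * h) *\<^sub>R D 3 0 + ((d2 * h)\<^sup>2 / 2) *\<^sub>R D 4 0
    + ((d2 * h) ^ 3 / 6) *\<^sub>R D 5 0 + (\<kappa>2 * h ^ 3) *\<^sub>R ?Gv))"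
  have R: "bigoh 4 R1" "bigoh 4 R2"
    unfolding R1_def R2_def by (intro bigoh_stage_slope Y1 Y2 d)+
  have w0: "bigoh 0 w1" "bigoh 0 w2"
    using bigoh_add[OF bigoh_le[OF w1, of 0] bigoh_const[of \<beta>1]]
      bigoh_add[OF bigoh_le[OF w2, of 0] bigoh_const[of \<beta>2]] by simp_all
  have moment: "bigoh 2 (\<lambda>h. w1 h * x + w2 h * y - z)" if "\<beta>1 * x + \<beta>2 * y = z" for x y z
  proof -
    have "bigoh 2 (\<lambda>h. x * (w1 h - \<beta>1) + y * (w2 h - \<beta>2))"
      by (intro bigoh_add bigoh_mult_left w1 w2)
    moreover have "x * (w1 h - \<beta>1) + y * (w2 h - \<beta>2) = w1 h * x + w2 h * y - z" for h
      using that by (simp add: algebra_simps)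
    ultimately show ?thesis by simp
  qed
  have m2: "bigoh 4 (\<lambda>h. h\<^sup>2 / 2 * (w1 h * d1\<^sup>2 + w2 h * d2\<^sup>2 - 1 / 12))"
    using bigoh_mult[OF bigoh_mult_left[OF bigoh_power[of 2], of "1 / 2"] moment[OF \<beta>(1)]] by simp
  have m3: "bigoh 4 (\<lambda>h. h ^ 3 / 6 * (w1 h * d1 ^ 3 + w2 h * d2 ^ 3 - 1 / 20))"
    using bigoh_le[OF bigoh_mult[OF bigoh_mult_left[OF bigoh_power[of 3], of "1 / 6"] moment[OF \<beta>(2)]], of 4] by simp
  have m\<kappa>: "bigoh 4 (\<lambda>h. h ^ 3 * (w1 h * \<kappa>1 + w2 h * \<kappa>2 - 0))"
    using bigoh_le[OF bigoh_mult[OF bigoh_power[of 3] moment[OF \<beta>(3)]], of 4] by simp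
  have m1': "bigoh 4 (\<lambda>h. h * (w1 h * d1 + w2 h * d2 - 1 / 6))"
    using bigoh_le[OF bigoh_mult[OF bigoh_power[of 1] m1], of 4] by simp
  have wR: "bigoh 4 (\<lambda>h. w1 h *\<^sub>R R1 h + w2 h *\<^sub>R R2 h)"
    using bigoh_scaleR[OF w0(1) R(1)] bigoh_scaleR[OF w0(2) R(2)] by (intro bigoh_add) simp_all
  have bracket: "bigoh 4 (\<lambda>h. (w1 h + w2 h - 1 / 2) *\<^sub>R D 2 0 + (h * (w1 h * d1 + w2 h * d2 - 1 / 6)) *\<^sub>R D 3 0
      + (h\<^sup>2 / 2 * (w1 h * d1\<^sup>2 + w2 h * d2\<^sup>2 - 1 / 12)) *\<^sub>R D 4 0
      + (h ^ 3 / 6 * (w1 h * d1 ^ 3 + w2 h * d2 ^ 3 - 1 / 20)) *\<^sub>R D 5 0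
      + (h ^ 3 * (w1 h * \<kappa>1 + w2 h * \<kappa>2 - 0)) *\<^sub>R ?Gv + (w1 h *\<^sub>R R1 h + w2 h *\<^sub>R R2 h))"
    by (rule bigoh_add bigoh_scaleR_left m0 m1' m2 m3 m\<kappa> wR)+
  have u6: "bigoh 6 (\<lambda>h. u h - (u 0 + h *\<^sub>R f (u 0) + (h\<^sup>2 / 2) *\<^sub>R D 2 0 + (h ^ 3 / 6) *\<^sub>R D 3 0
      + (h ^ 4 / 24) *\<^sub>R D 4 0 + (h ^ 5 / 120) *\<^sub>R D 5 0))"
    using solution_expansion[of 0 6 1] by (simp add: D_def eval_nat_numeral fact_numeral mult_ac)
  have "bigoh 6 (\<lambda>h. h\<^sup>2 *\<^sub>R ((w1 h + w2 h - 1 / 2) *\<^sub>R D 2 0 + (h * (w1 h * d1 + w2 h * d2 - 1 / 6)) *\<^sub>R D 3 0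
      + (h\<^sup>2 / 2 * (w1 h * d1\<^sup>2 + w2 h * d2\<^sup>2 - 1 / 12)) *\<^sub>R D 4 0
      + (h ^ 3 / 6 * (w1 h * d1 ^ 3 + w2 h * d2 ^ 3 - 1 / 20)) *\<^sub>R D 5 0
      + (h ^ 3 * (w1 h * \<kappa>1 + w2 h * \<kappa>2 - 0)) *\<^sub>R ?Gv + (w1 h *\<^sub>R R1 h + w2 h *\<^sub>R R2 h)))"
    using bigoh_scaleR[OF bigoh_power[of 2] bracket] by simp
  from bigoh_diff[OF u6 this] show ?thesis
  proof (rule bigoh_cong, intro always_eventually allI)
    fix h
    show "u h - (u 0 + h *\<^sub>R f (u 0) + h\<^sup>2 *\<^sub>R (w1 h *\<^sub>R g (Y1 h) + w2 h *\<^sub>R g (Y2 h))) =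
      u h - (u 0 + h *\<^sub>R f (u 0) + (h\<^sup>2 / 2) *\<^sub>R D 2 0 + (h ^ 3 / 6) *\<^sub>R D 3 0
      + (h ^ 4 / 24) *\<^sub>R D 4 0 + (h ^ 5 / 120) *\<^sub>R D 5 0)
      - h\<^sup>2 *\<^sub>R ((w1 h + w2 h - 1 / 2) *\<^sub>R D 2 0 + (h * (w1 h * d1 + w2 h * d2 - 1 / 6)) *\<^sub>R D 3 0
      + (h\<^sup>2 / 2 * (w1 h * d1\<^sup>2 + w2 h * d2\<^sup>2 - 1 / 12)) *\<^sub>R D 4 0
      + (h ^ 3 / 6 * (w1 h * d1 ^ 3 + w2 h * d2 ^ 3 - 1 / 20)) *\<^sub>R D 5 0
      + (h ^ 3 * (w1 h * \<kappa>1 + w2 h * \<kappa>2 - 0)) *\<^sub>R ?Gv + (w1 h *\<^sub>R R1 h + w2 h *\<^sub>R R2 h))"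
      unfolding R1_def R2_def
      by (rule euclidean_eqI, unfold inner_diff_left inner_add_left inner_scaleR_left)
        (simp add: field_simps eval_nat_numeral)
  qed
qed

text \<open>Diagonal implicitness decouples the system: the first stage is solved alone and is data
  for the second, so existence and uniqueness hold one component at a time.\<close>

lemma local_error:
  assumes \<omega>: "\<omega> > 0"
  shows "\<exists>Y. (\<forall>\<^sub>F h in at_right 0. Y h \<in> {1..2} \<rightarrow>\<^sub>E ball (u 0) r \<and> stage_equations ef_tddirk f \<omega> h (u 0) (Y h) \<and>
        (\<forall>Z \<in> {1..2} \<rightarrow>\<^sub>E ball (u 0) r. stage_equations ef_tddirk f \<omega> h (u 0) Z \<longrightarrow> Z = Y h)) \<and>
      bigoh 6 (\<lambda>h. u h - step_value ef_tddirk f \<omega> h (u 0) (Y h))"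
proof -
  obtain L where L: "L > 0"
    "\<And>x y. x \<in> cball (u 0) r \<Longrightarrow> y \<in> cball (u 0) r \<Longrightarrow> norm (g x - g y) \<le> L * norm (x - y)"
    using g_lipschitz by blast
  define x1 x2 \<alpha>1 \<alpha>2 where
    "x1 h = Re (xi1 (mu_of \<omega> h)) * c1" and "x2 h = Re (xi2 (mu_of \<omega> h)) * c2" and
    "\<alpha>1 h = Re (a11 (mu_of \<omega> h))" and "\<alpha>2 h = Re (a22 (mu_of \<omega> h))" for h
  note coeff = stage_coefficients_expansion[OF \<omega>, folded x1_def x2_def \<alpha>1_def \<alpha>2_def]
  have c: "c1 > 0" "c2 > 0" using c1_pos c1_less_c2 by auto
  have bounded: "bigoh 0 a" if "bigoh n (\<lambda>h. a h - k)" for a :: "real \<Rightarrow> real" and n k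
    using bigoh_add[OF bigoh_le[OF that, of 0] bigoh_const[of k]] by simp
  have x_small: "((\<lambda>h. (x h * h) *\<^sub>R v) \<longlongrightarrow> 0) (at_right 0)"
    if "bigoh 3 (\<lambda>h. x h - (k + m * (\<omega> * h)\<^sup>2))" for x k m and v :: 'a
  proof -
    have "bigoh 0 (\<lambda>h::real. h\<^sup>2)" by (rule bigoh_le[OF bigoh_power]) simp
    from bigoh_add[OF bigoh_const[of k] bigoh_mult_left[OF this, of "m * \<omega>\<^sup>2"]]
    have "bigoh 0 (\<lambda>h. k + m * (\<omega> * h)\<^sup>2)" by (simp add: power_mult_distrib mult.assoc)
    from bigoh_add[OF bigoh_le[OF that, of 0] this] have "bigoh 0 x" by simp
    from bigoh_scaleR_left[OF bigoh_mult[OF this bigoh_power[of 1]], of v] show ?thesis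
      by (intro bigoh_imp_tendsto_0[of 1]) simp_all
  qed
  have a_small: "((\<lambda>h. h\<^sup>2 * a h) \<longlongrightarrow> 0) (at_right 0)" if "bigoh 2 (\<lambda>h. a h - k)" for a k
    using bigoh_mult[OF bigoh_power[of 2] bounded[OF that]] by (intro bigoh_imp_tendsto_0[of 2]) simp_all

  define A1 where "A1 = (\<lambda>h. u 0 + (x1 h * h) *\<^sub>R f (u 0))"
  define Y1 where "Y1 = (\<lambda>h. THE X. X \<in> ball (u 0) r \<and> X = A1 h + (h\<^sup>2 * \<alpha>1 h) *\<^sub>R g X)"
  have "(A1 \<longlongrightarrow> u 0 + 0) (at_right 0)"
    unfolding A1_def by (intro tendsto_add tendsto_const x_small[OF coeff(1)])
  then have unique1: "\<forall>\<^sub>F h in at_right 0. \<exists>!X. X \<in> ball (u 0) r \<and> X = A1 h + (h\<^sup>2 * \<alpha>1 h) *\<^sub>R g X"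
    using eventually_implicit_stage[OF L(2) L(1) r_pos _ a_small[OF coeff(3)]] by simp
  then have Y1: "\<forall>\<^sub>F h in at_right 0. Y1 h \<in> ball (u 0) r \<and> Y1 h = A1 h + (h\<^sup>2 * \<alpha>1 h) *\<^sub>R g (Y1 h)"
    by eventually_elim (unfold Y1_def, rule theI')
  then have Y1_ball: "\<forall>\<^sub>F h in at_right 0. Y1 h \<in> ball (u 0) r" by eventually_elim simp

  define A2 where "A2 = (\<lambda>h. u 0 + (x2 h * h) *\<^sub>R f (u 0) + (h\<^sup>2 * phi) *\<^sub>R g (Y1 h))"
  define Y2 where "Y2 = (\<lambda>h. THE X. X \<in> ball (u 0) r \<and> X = A2 h + (h\<^sup>2 * \<alpha>2 h) *\<^sub>R g X)"
  have "((\<lambda>h. (h\<^sup>2 * phi) *\<^sub>R g (Y1 h)) \<longlongrightarrow> 0) (at_right 0)"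
    using bigoh_scaleR[OF bigoh_mult_left[OF bigoh_power[of 2], of phi] bigoh_g_bounded[OF Y1_ball]]
    by (intro bigoh_imp_tendsto_0[of 2]) (simp_all add: mult.commute)
  then have "(A2 \<longlongrightarrow> u 0 + 0 + 0) (at_right 0)"
    unfolding A2_def by (intro tendsto_add tendsto_const x_small[OF coeff(2)])
  then have unique2: "\<forall>\<^sub>F h in at_right 0. \<exists>!X. X \<in> ball (u 0) r \<and> X = A2 h + (h\<^sup>2 * \<alpha>2 h) *\<^sub>R g X"
    using eventually_implicit_stage[OF L(2) L(1) r_pos _ a_small[OF coeff(4)]] by simp
  then have Y2: "\<forall>\<^sub>F h in at_right 0. Y2 h \<in> ball (u 0) r \<and> Y2 h = A2 h + (h\<^sup>2 * \<alpha>2 h) *\<^sub>R g (Y2 h)"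
    by eventually_elim (unfold Y2_def, rule theI')

  \<comment> \<open>Restriction makes the stage family extensional, so uniqueness is equality of
    functions.\<close>
  define Y where "Y = (\<lambda>h. restrict (\<lambda>i::nat. if i = 1 then Y1 h else Y2 h) {1..2})"
  have stages: "stage_equations ef_tddirk f \<omega> h (u 0) Z \<longleftrightarrow>
      Z 1 = A1 h + (h\<^sup>2 * \<alpha>1 h) *\<^sub>R g (Z 1) \<and>
      Z 2 = u 0 + (x2 h * h) *\<^sub>R f (u 0) + (h\<^sup>2 * phi) *\<^sub>R g (Z 1) + (h\<^sup>2 * \<alpha>2 h) *\<^sub>R g (Z 2)" for h Z
    unfolding stage_equations_def atLeastAtMost_1_2
    by (simp add: atLeastAtMost_1_2 A1_def x1_def x2_def \<alpha>1_def \<alpha>2_def a21_def scaleR_add_right add.assoc)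
  have "\<forall>\<^sub>F h in at_right 0. Y h \<in> {1..2} \<rightarrow>\<^sub>E ball (u 0) r \<and> stage_equations ef_tddirk f \<omega> h (u 0) (Y h) \<and>
        (\<forall>Z \<in> {1..2} \<rightarrow>\<^sub>E ball (u 0) r. stage_equations ef_tddirk f \<omega> h (u 0) Z \<longrightarrow> Z = Y h)"
    using Y1 Y2 unique1 unique2
  proof eventually_elim
    case (elim h)
    have Yh: "Y h 1 = Y1 h" "Y h 2 = Y2 h" by (simp_all add: Y_def)
    have mem: "Y h \<in> {1..2} \<rightarrow>\<^sub>E ball (u 0) r" using elim by (auto simp: Y_def)
    have eqs: "stage_equations ef_tddirk f \<omega> h (u 0) (Y h)"
      unfolding stages Yh using elim(1,2) unfolding A2_def by blast
    have "Z = Y h" if Z: "Z \<in> {1..2} \<rightarrow>\<^sub>E ball (u 0) r" "stage_equations ef_tddirk f \<omega> h (u 0) Z" for Z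
    proof -
      have ball: "Z 1 \<in> ball (u 0) r" "Z 2 \<in> ball (u 0) r"
        using Z(1) by (auto simp: PiE_iff)
      have 1: "Z 1 = Y1 h"
        using Z(2) ball(1) elim(1,3) unfolding stages by blast
      then have "Z 2 = A2 h + (h\<^sup>2 * \<alpha>2 h) *\<^sub>R g (Z 2)"
        using Z(2) unfolding stages A2_def by simp
      then have 2: "Z 2 = Y2 h"
        using ball(2) elim(2,4) by blast
      show ?thesis
        by (rule PiE_ext[OF Z(1) mem]) (use 1 2 Yh in \<open>auto simp: atLeastAtMost_1_2\<close>)
    qed
    then show ?case using mem eqs by blast
  qed
  moreover have "bigoh 6 (\<lambda>h. u h - step_value ef_tddirk f \<omega> h (u 0) (Y h))"
  proof -
    let ?v = "D 3 0 + \<omega>\<^sup>2 *\<^sub>R D 1 0"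
    have Y1_error: "bigoh 4 (\<lambda>h. Y1 h - u (c1 * h) - (c1 ^ 3 / 3 * h ^ 3) *\<^sub>R ?v)"
    proof -
      \<comment> \<open>The first stage has no predecessor: p = 0, with the exact solution as a
        placeholder for \<open>Z\<close>.\<close>
      have "\<forall>\<^sub>F h in at_right 0. Y1 h \<in> ball (u 0) r \<and>
          Y1 h = u 0 + (x1 h * h) *\<^sub>R f (u 0) + h\<^sup>2 *\<^sub>R (0 *\<^sub>R g (u (c1 * h)) + \<alpha>1 h *\<^sub>R g (Y1 h))"
        using Y1 by (simp add: A1_def)
      moreover have "\<forall>\<^sub>F h in at_right 0. u (c1 * h) \<in> ball (u 0) r"
        using eventually_solution_in_ball[OF c(1) r_pos] by (simp add: dist_norm norm_minus_commute)
      moreover have "bigoh 2 (\<lambda>h. u (c1 * h) - u (c1 * h))"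
        using bigoh_scaleR_left[OF bigoh_power[of 2], of "0 :: 'a"] by simp
      ultimately show ?thesis
        using stage_error[OF c(1) c(1), of Y1 x1 0 "\<lambda>h. u (c1 * h)" \<alpha>1 \<omega>] coeff(1,3) by simp
    qed
    have "bigoh 3 (\<lambda>h. (c1 ^ 3 / 3 * h ^ 3) *\<^sub>R ?v)"
      by (intro bigoh_scaleR_left bigoh_mult_left bigoh_power)
    from bigoh_le[OF bigoh_add[OF bigoh_le[OF Y1_error, of 3] this], of 2]
    have "bigoh 2 (\<lambda>h. Y1 h - u (c1 * h))" by simp
    moreover have "\<forall>\<^sub>F h in at_right 0. Y2 h \<in> ball (u 0) r \<and>
        Y2 h = u 0 + (x2 h * h) *\<^sub>R f (u 0) + h\<^sup>2 *\<^sub>R (phi *\<^sub>R g (Y1 h) + \<alpha>2 h *\<^sub>R g (Y2 h))"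
      using Y2 by (simp add: A2_def scaleR_add_right add.assoc)
    ultimately have Y2_error: "bigoh 4 (\<lambda>h. Y2 h - u (c2 * h) - ((c2 ^ 3 / 3 - phi * (c2 - c1)) * h ^ 3) *\<^sub>R ?v)"
      using stage_error[OF c(2) c(1), of Y2 x2 phi Y1 \<alpha>2 \<omega>] Y1_ball coeff(2,4) by blast
    \<comment> \<open>The cancellation that fixes \<open>phi\<close>: (1/20)/3 - 1/60 = 0.\<close>
    have "b1_0 * (c1 ^ 3 / 3) + b2_0 * (c2 ^ 3 / 3 - phi * (c2 - c1))
        = (b1_0 * c1 ^ 3 + b2_0 * c2 ^ 3) / 3 - b2_0 * (phi * (c2 - c1))"
      by (simp add: algebra_simps add_divide_distrib)
    also have "\<dots> = 0" unfolding limit_order_conditions by simp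
    finally have "b1_0 * (c1 ^ 3 / 3) + b2_0 * (c2 ^ 3 / 3 - phi * (c2 - c1)) = 0" .
    from step_error[OF c Y1_error Y2_error weights_expansion[OF \<omega>] limit_order_conditions(3,4) this]
    show ?thesis
      by (simp add: step_value_def Y_def atLeastAtMost_1_2 add.assoc)
  qed
  ultimately show ?thesis by blast
qed

end

lemma consistent_of_order_five:
  fixes U :: "'a::euclidean_space set"
  assumes \<omega>: "\<omega> > 0" and U: "open U" "Ck_on 5 U f"
  shows "consistent_of_order 5 ef_tddirk \<omega> U f"
  unfolding consistent_of_order_def
proof (intro allI impI, elim conjE)
  fix xn T :: real and yn :: 'a and y
  assume T: "T > 0" and yn: "y xn = yn"
    and sol: "\<forall>x\<in>{xn..xn + T}. y x \<in> U \<and> (y has_vector_derivative f (y x)) (at x within {xn..xn + T})"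
  define u where "u = (\<lambda>s. y (xn + s))"
  have "yn \<in> U" using sol T yn by auto
  \<comment> \<open>Any closed ball in \<open>U\<close> serves as the neighbourhood, since only
    \<open>h\<close> has to be small.\<close>
  then obtain r where r: "r > 0" "cball yn r \<subseteq> U"
    using U(1) open_contains_cball by blast
  have "(u has_vector_derivative f (u t)) (at t within {0..T})" if "t \<in> {0..T}" for t
  proof -
    have "((+) xn has_vector_derivative 1) (at t within {0..T})"
      by (auto intro!: derivative_eq_intros)
    moreover have "(y has_vector_derivative f (u t)) (at (xn + t) within (+) xn ` {0..T})"
      using sol that by (simp add: u_def add.commute)
    ultimately have "(y \<circ> (+) xn has_vector_derivative 1 *\<^sub>R f (u t)) (at t within {0..T})"
      by (rule vector_diff_chain_within)
    then show ?thesis by (simp add: u_def o_def)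
  qed
  then interpret smooth_solution f U u T r
    using U T sol r yn by unfold_locales (auto simp: u_def)
  obtain Y where "\<forall>\<^sub>F h in at_right 0. Y h \<in> {1..2} \<rightarrow>\<^sub>E ball yn r \<and> stage_equations ef_tddirk f \<omega> h yn (Y h) \<and>
        (\<forall>Z \<in> {1..2} \<rightarrow>\<^sub>E ball yn r. stage_equations ef_tddirk f \<omega> h yn Z \<longrightarrow> Z = Y h)"
    and "bigoh 6 (\<lambda>h. u h - step_value ef_tddirk f \<omega> h yn (Y h))"
    using local_error[OF \<omega>] yn by (auto simp: u_def)
  then show "\<exists>r>0. \<exists>Y. cball yn r \<subseteq> U \<and>
           (\<forall>\<^sub>F h in at_right 0.
              real_coefficients ef_tddirk (mu_of \<omega> h) \<and>
              Y h \<in> {1..2} \<rightarrow>\<^sub>E ball yn r \<and> stage_equations ef_tddirk f \<omega> h yn (Y h) \<and>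
              (\<forall>Z \<in> {1..2} \<rightarrow>\<^sub>E ball yn r. stage_equations ef_tddirk f \<omega> h yn Z \<longrightarrow> Z = Y h)) \<and>
           (\<lambda>h. norm (y (xn + h) - step_value ef_tddirk f \<omega> h yn (Y h))) \<in> O[at_right 0](\<lambda>h. h ^ (5 + 1))"
    using r eventually_real_coefficients[OF \<omega>] unfolding bigoh_iff_landau u_def
    by (intro exI[of _ r] exI[of _ Y] conjI) (auto intro: eventually_conj)
qed

theorem mainTheorem5:
  fixes \<omega> :: real
  assumes "\<omega> > 0"
  shows "(\<forall>h\<ge>0. denominators_nonzero (mu_of \<omega> h) \<longrightarrow>
            exponentially_fitted_at ef_tddirk (mu_of \<omega> h)) \<and>
         (\<forall>(U :: 'a::euclidean_space set) f. open U \<and> Ck_on 5 U f \<longrightarrow>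
            consistent_of_order 5 ef_tddirk \<omega> U f)"
  using exponentially_fitted consistent_of_order_five[OF assms] by blast

end
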